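(* Let $d> m\ge 2$ be integers, and let $K$ be a field of characteristic $0$ which is either a number field or a function field of finite transcendence degree over another field. Let $t_1,\dots,t_m$ be algebraically independent variables, let $\mathbf{f}_{\mathbf{t}}(z)=z^d+t_1z^{m-1}+t_2z^{m-2}+\cdots+t_{m-1}z+t_m$, and let $\Phi:\mathbb{P}^m\longrightarrow\mathbb{P}^m$ be the $m$-parameter family of endomorphisms $$\Phi([X_m:\cdots:X_1:X_0])=\left[X_0^d\,\mathbf{f}_{\mathbf{t}}\!\left(\tfrac{X_m}{X_0}\right):\cdots:X_0^d\,\mathbf{f}_{\mathbf{t}}\!\left(\tfrac{X_1}{X_0}\right):X_0^d\right].$$ For $\boldsymbol{\lambda}=(\lambda_1,\dots,\lambda_m)\in\mathbb{A}^m(\overline{K})$ let $\Phi_{\boldsymbol{\lambda}}:\mathbb{P}^m\to\mathbb{P}^m$ be the endomorphism defined over $\overline{K}$ obtained by specializing each $t_i$ to $\lambda_i$. Let $c_1,\dots,c_m\in\overline{K}$ be distinct elements, and let $P:=[c_m:\cdots:c_1:1]\in\mathbb{P}^m(\overline{K})$. Let $\widehat{h}_{\Phi_{\boldsymbol{\lambda}}}(P)$ be the canonical height of $P$ with respect to $\Phi_{\boldsymbol{\lambda}}$ (over $\overline{K}$), and let $\widehat{h}_{\Phi}(P)$ be the canonical height of $P$ with respect to $\Phi$ viewed as an endomorphism of $\mathbb{P}^m$ defined over $\overline{K}(t_1,\dots,t_m)$. Then for all $\boldsymbol{\lambda}=(\lambda_1,\dots,\lambda_m)\in\mathbb{A}^m(\overline{K})$,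 $$\widehat{h}_{\Phi_{\boldsymbol{\lambda}}}(P)=\widehat{h}_\Phi(P)\cdot h\left((\lambda_1,\dots,\lambda_m)\right)+O(1),$$ where $h((\lambda_1,\dots,\lambda_m))$ is the Weil height of the point $(\lambda_1,\dots,\lambda_m)\in\mathbb{A}^m(\overline{K})$ and the constant in $O(1)$ depends on $c_1,\dots,c_m$ only (in particular, it does not depend on $\boldsymbol{\lambda}$).
   Context: The field $K$ is a product formula field: it is equipped with a standard set $\Omega_K$ of absolute values $|\cdot|_v$ and a function $N:\Omega_K\to\mathbb{N}$, $N_v:=N(v)$, such that $\prod_{v\in\Omega_K}|x|_v^{N_v}=1$ for every $x\in K^*$. If $K$ is a number field these are the usual places; if $K$ is a function field over a constant field $F$, they are the absolute values associated to the irreducible divisors of a smooth projective variety $\mathcal{V}$ over $F$ with function field $K$ (and for $K=F(t_1,\dots,t_\ell)$ one takes $\mathcal{V}=\mathbb{P}^\ell$). For each $v$, $\mathbb{C}_v$ is the completion of an algebraic closure of the completion of $(K,|\cdot|_v)$; $|\cdot|_v$ is extended to $\mathbb{C}_v$ and an embedding $\overline{K}\hookrightarrow\mathbb{C}_v$ is fixed. Weil height: for a finite extension $L/K$ and $P=[x_m:\cdots:x_0]\in\mathbb{P}^m(L)$, $$h(P)=\frac{1}{[L:K]}\sum_{v\in\Omega_K}N_v\sum_{\sigma:L\hookrightarrow\overline{K},\ \sigma|_K=\mathrm{id}}\log\max\{|\sigma(x_m)|_v,\dots,|\sigma(x_0)|_v\},$$ which is independent of the choice of $L$. For an affine point, $h((x_m,\dots,x_1)):=h([x_m:\cdots:x_1:1])$.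 For a function field $F(t_1,\dots,t_\ell)$ and coprime polynomials $x_0,\dots,x_m\in F[t_1,\dots,t_\ell]$, one has $h([x_m:\cdots:x_0])=\max_i\deg(x_i)$ with $\deg$ the total degree; this is the height used over $\overline{K}(t_1,\dots,t_m)$ (with constant field $\overline{K}$). Canonical height (Call–Silverman): for an endomorphism $f:\mathbb{P}^m\to\mathbb{P}^m$ of degree $d\ge2$, $\widehat{h}_f(x)=\lim_{n\to\infty}h(f^n(x))/d^n$, where $f^n$ is the $n$-th iterate. *)

theory Defs
  imports
    "HOL-Analysis.Analysis"
    "HOL-Algebra.Generated_Rings"
    "HOL-Algebra.Generated_Fields"
    "HOL-Algebra.Algebraic_Closure_Type"
    "HOL-Library.Poly_Mapping"
    "HOL-Computational_Algebra.Fraction_Field"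
begin

text \<open>
  The ground field \<open>K\<close> is the type \<open>'k\<close>; its algebraic closure is the library type
  \<open>'k alg_closure\<close>, with inclusion \<open>to_ac\<close>. Points of projective \<open>m\<close>-space are given by
  homogeneous coordinates \<open>x :: nat \<Rightarrow> _\<close>, of which only \<open>x 0, \<dots>, x m\<close> matter.
\<close>

abbreviation type_ring :: "'a::field ring"
  where "type_ring \<equiv> ring_of_type_algebra"

abbreviation sub_ring :: "'a::field set \<Rightarrow> 'a ring"
  where "sub_ring A \<equiv> type_ring\<lparr>carrier := A\<rparr>"


section \<open>Absolute values and the standard places\<close>

definition absolute_value :: "('a::field \<Rightarrow> real) \<Rightarrow> bool" where
  "absolute_value v \<longleftrightarrow>
     (\<forall>x. v x \<ge> 0) \<and> (\<forall>x. v x = 0 \<longleftrightarrow> x = 0) \<and>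
     (\<forall>x y. v (x * y) = v x * v y) \<and> (\<forall>x y. v (x + y) \<le> v x + v y)"

text \<open>
  A product over \<open>\<Omega>\<close> is meaningful only if almost all factors are \<open>1\<close>; as usual, this is
  part of the product formula.
\<close>

definition product_formula :: "('k::field \<Rightarrow> real) set \<Rightarrow> (('k \<Rightarrow> real) \<Rightarrow> nat) \<Rightarrow> bool" where
  "product_formula \<Omega> N \<longleftrightarrow>
     (\<forall>x. x \<noteq> 0 \<longrightarrow>
        finite {v \<in> \<Omega>. v x \<noteq> 1} \<and> (\<Prod>v | v \<in> \<Omega> \<and> v x \<noteq> 1. v x ^ N v) = 1)"

text \<open>
  Choosing an embedding of the algebraic closure of \<open>K\<close> into \<open>\<complex>\<^sub>v\<close> amounts to choosing an
  extension of \<open>v\<close> to the algebraic closure: the absolute value of \<open>\<complex>\<^sub>v\<close> restricts to such an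
  extension, and conversely the completion of the algebraic closure with respect to any
  extension is a copy of \<open>\<complex>\<^sub>v\<close>.
\<close>

definition extends_to_closure ::
    "('k::field \<Rightarrow> real) \<Rightarrow> ('k alg_closure \<Rightarrow> real) \<Rightarrow> bool" where
  "extends_to_closure v w \<longleftrightarrow> absolute_value w \<and> (\<forall>x. w (to_ac x) = v x)"


subsection \<open>Number fields\<close>

definition is_number_field :: "'k::field_char_0 itself \<Rightarrow> bool" where
  "is_number_field _ \<longleftrightarrow>
     (\<exists>B::'k set. finite B \<and> module.span (\<lambda>(q::rat) x. of_rat q * x) B = UNIV)"

definition padic_abs :: "nat \<Rightarrow> rat \<Rightarrow> real" where
  "padic_abs p q =
     (if q = 0 then 0
      else real p powi (int (multiplicity (int p) (snd (quotient_of q)))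
                        - int (multiplicity (int p) (fst (quotient_of q)))))"

definition number_field_places :: "('k::field_char_0 \<Rightarrow> real) set" where
  "number_field_places =
     {v. absolute_value v \<and>
         ((\<forall>q. v (of_rat q) = \<bar>real_of_rat q\<bar>) \<or>
          (\<exists>p. Factorial_Ring.prime p \<and> (\<forall>q. v (of_rat q) = padic_abs p q)))}"


subsection \<open>Function fields\<close>

text \<open>
  An integral closed subvariety \<open>V\<close> of \<open>n\<close>-dimensional projective space over \<open>F\<close>, together with
  an identification of its function field with \<open>K\<close>, is the same thing as the homogeneous
  coordinates \<open>\<xi> 0, \<dots>, \<xi> n\<close> in \<open>K\<close> (up to scaling) of its generic point, where the ratios of
  the coordinates generate \<open>K\<close> over \<open>F\<close>. The coordinate ring of the affine chart \<open>\<xi> i \<noteq> 0\<close> is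
  then \<open>F[\<xi> 0 / \<xi> i, \<dots>, \<xi> n / \<xi> i]\<close>, the points of \<open>V\<close> in that chart are the primes of this
  ring, and all local rings of \<open>V\<close> are subrings of \<open>K\<close>.
\<close>

definition chart_ring :: "'k::field set \<Rightarrow> nat \<Rightarrow> (nat \<Rightarrow> 'k) \<Rightarrow> nat \<Rightarrow> 'k set" where
  "chart_ring F n \<xi> i = generate_ring type_ring (F \<union> {\<xi> j / \<xi> i |j. j \<le> n})"

text \<open>The maximal length of a chain of primes of \<open>A\<close> ending in \<open>P\<close>; it exists as charts have finite dimension.\<close>

definition prime_height :: "'k::field set \<Rightarrow> 'k set \<Rightarrow> nat" where
  "prime_height A P =
     (GREATEST h. \<exists>Q. (\<forall>i\<le>h. primeideal (Q i) (sub_ring A)) \<and> (\<forall>i<h. Q i \<subset> Q (Suc i)) \<and> Q h = P)"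

definition local_ring :: "'k::field set \<Rightarrow> 'k set \<Rightarrow> 'k set" where
  "local_ring A P = {a / s |a s. a \<in> A \<and> s \<in> A - P}"

text \<open>
  The localization of \<open>A\<close> at \<open>P\<close> is a regular local ring: its maximal ideal is generated by as
  many elements as its Krull dimension, which is the height of \<open>P\<close>.
\<close>

definition regular_at :: "'k::field set \<Rightarrow> 'k set \<Rightarrow> bool" where
  "regular_at A P \<longleftrightarrow>
     (\<exists>G \<subseteq> P. finite G \<and> card G \<le> prime_height A P \<and>
        (\<forall>a\<in>P. \<exists>s \<in> A - P. s * a \<in> genideal (sub_ring A) G))"

text \<open>Over the perfect field \<open>F\<close> (characteristic \<open>0\<close>), smooth means that all local rings are regular.\<close>

definition smooth_projective_model :: "'k::field_char_0 set \<Rightarrow> nat \<Rightarrow> (nat \<Rightarrow> 'k) \<Rightarrow> bool" where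
  "smooth_projective_model F n \<xi> \<longleftrightarrow>
     subfield F type_ring \<and>
     (\<exists>i\<le>n. \<xi> i \<noteq> 0) \<and>
     generate_field type_ring (F \<union> {\<xi> j / \<xi> i |i j. i \<le> n \<and> j \<le> n \<and> \<xi> i \<noteq> 0}) = UNIV \<and>
     (\<forall>i\<le>n. \<xi> i \<noteq> 0 \<longrightarrow>
        (\<forall>P. primeideal P (sub_ring (chart_ring F n \<xi> i)) \<longrightarrow> regular_at (chart_ring F n \<xi> i) P))"

text \<open>
  An irreducible divisor \<open>Z\<close> is a point of codimension one, and its absolute value is
  \<open>x \<mapsto> exp (- ord\<^sub>Z x)\<close>: the absolute value on \<open>K\<close> whose valuation ring is the local ring of \<open>V\<close>
  at the generic point of \<open>Z\<close> and whose value group is \<open>exp \<int>\<close>.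
\<close>

definition divisor_places :: "'k::field_char_0 set \<Rightarrow> nat \<Rightarrow> (nat \<Rightarrow> 'k) \<Rightarrow> ('k \<Rightarrow> real) set" where
  "divisor_places F n \<xi> =
     {v. absolute_value v \<and>
         v ` (UNIV - {0}) = range (\<lambda>k::int. exp (real_of_int k)) \<and>
         (\<exists>i\<le>n. \<exists>P. \<xi> i \<noteq> 0 \<and>
            primeideal P (sub_ring (chart_ring F n \<xi> i)) \<and>
            prime_height (chart_ring F n \<xi> i) P = 1 \<and>
            {x. v x \<le> 1} = local_ring (chart_ring F n \<xi> i) P)}"

definition standard_places :: "('k::field_char_0 \<Rightarrow> real) set \<Rightarrow> bool" where
  "standard_places \<Omega> \<longleftrightarrow>
     (is_number_field TYPE('k) \<and> \<Omega> = number_field_places) \<or>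
     (\<exists>F n \<xi>. smooth_projective_model F n \<xi> \<and> \<Omega> = divisor_places F n \<xi>)"


section \<open>Heights\<close>

definition ext_degree :: "'k::field alg_closure set \<Rightarrow> nat" where
  "ext_degree L = vector_space.dim (\<lambda>(k::'k) x. to_ac k * x) L"

definition K_embeddings ::
    "'k::field alg_closure set \<Rightarrow> ('k alg_closure \<Rightarrow> 'k alg_closure) set" where
  "K_embeddings L =
     {\<sigma> \<in> extensional L. \<sigma> \<in> ring_hom (sub_ring L) type_ring \<and> (\<forall>k. \<sigma> (to_ac k) = to_ac k)}"

definition coord_field :: "nat \<Rightarrow> (nat \<Rightarrow> 'k::field alg_closure) \<Rightarrow> 'k alg_closure set" where
  "coord_field m x = generate_field type_ring (range to_ac \<union> x ` {..m})"

text \<open>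
  The height does not depend on the choice of the finite extension \<open>L\<close> of \<open>K\<close> containing the
  coordinates; we take the field generated by them. \<open>E v\<close> is the chosen extension of \<open>v\<close>.
\<close>

definition weil_height ::
    "('k::field \<Rightarrow> real) set \<Rightarrow> (('k \<Rightarrow> real) \<Rightarrow> nat) \<Rightarrow>
     (('k \<Rightarrow> real) \<Rightarrow> 'k alg_closure \<Rightarrow> real) \<Rightarrow> nat \<Rightarrow> (nat \<Rightarrow> 'k alg_closure) \<Rightarrow> real" where
  "weil_height \<Omega> N E m x =
     (let L = coord_field m x in
        1 / real (ext_degree L) *
        (\<Sum>\<^sub>\<infinity>v\<in>\<Omega>. real (N v) * (\<Sum>\<sigma>\<in>K_embeddings L. ln (MAX i\<in>{..m}. E v (\<sigma> (x i))))))"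

definition affine_point :: "(nat \<Rightarrow> 'a::one) \<Rightarrow> nat \<Rightarrow> 'a" where
  "affine_point a = a(0 := 1)"

definition canonical_height ::
    "((nat \<Rightarrow> 'a) \<Rightarrow> real) \<Rightarrow> nat \<Rightarrow> ((nat \<Rightarrow> 'a) \<Rightarrow> (nat \<Rightarrow> 'a)) \<Rightarrow> (nat \<Rightarrow> 'a) \<Rightarrow> real" where
  "canonical_height h d f x = lim (\<lambda>n. h ((f ^^ n) x) / real d ^ n)"


section \<open>The rational function field in the parameters\<close>

text \<open>
  Polynomials in \<open>t\<^sub>0, t\<^sub>1, \<dots>\<close> over \<open>'b\<close>; \<open>polys_in m\<close> is the subring \<open>'b[t\<^sub>1, \<dots>, t\<^sub>m]\<close>. The field
  \<open>'b(t\<^sub>1, \<dots>, t\<^sub>m)\<close> is regarded as a subfield of the fraction field of the large ring.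
\<close>

type_synonym 'b mpolys = "(nat \<Rightarrow>\<^sub>0 nat) \<Rightarrow>\<^sub>0 'b"

definition polys_in :: "nat \<Rightarrow> 'b::zero mpolys set" where
  "polys_in m = {p. \<forall>e \<in> Poly_Mapping.keys p. Poly_Mapping.keys e \<subseteq> {1..m}}"

definition total_deg :: "'b::zero mpolys \<Rightarrow> nat" where
  "total_deg p = Max (insert 0 ((\<lambda>e. \<Sum>i\<in>Poly_Mapping.keys e. Poly_Mapping.lookup e i) ` Poly_Mapping.keys p))"

definition frac_of_poly :: "'b::idom mpolys \<Rightarrow> 'b mpolys fract" where
  "frac_of_poly p = Fract p 1"

definition frac_const :: "'b::idom \<Rightarrow> 'b mpolys fract" where
  "frac_const a = frac_of_poly (Poly_Mapping.single 0 a)"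

definition frac_var :: "nat \<Rightarrow> 'b::idom mpolys fract" where
  "frac_var i = frac_of_poly (Poly_Mapping.single (Poly_Mapping.single i 1) 1)"

definition coprime_coords :: "nat \<Rightarrow> (nat \<Rightarrow> 'b::idom mpolys) \<Rightarrow> bool" where
  "coprime_coords m y \<longleftrightarrow> (\<forall>g \<in> polys_in m. (\<forall>i\<le>m. g dvd y i) \<longrightarrow> g dvd 1)"

definition generic_height :: "nat \<Rightarrow> (nat \<Rightarrow> 'b::idom mpolys fract) \<Rightarrow> real" where
  "generic_height m x =
     (THE h. \<exists>y s. s \<noteq> 0 \<and> (\<forall>i\<le>m. y i \<in> polys_in m \<and> x i = s * frac_of_poly (y i)) \<and>
        coprime_coords m y \<and> h = real (MAX i\<in>{..m}. total_deg (y i)))"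


section \<open>The family of endomorphisms\<close>

text \<open>\<open>x\<^sub>0\<^sup>d f\<^sub>t(x / x\<^sub>0)\<close> with denominators cleared, for \<open>f\<^sub>t(z) = z\<^sup>d + t\<^sub>1 z\<^sup>m\<^sup>-\<^sup>1 + \<dots> + t\<^sub>m\<close>.\<close>

definition homog_f :: "nat \<Rightarrow> nat \<Rightarrow> (nat \<Rightarrow> 'a::comm_ring_1) \<Rightarrow> 'a \<Rightarrow> 'a \<Rightarrow> 'a" where
  "homog_f d m t x0 x = x ^ d + (\<Sum>j=1..m. t j * x ^ (m - j) * x0 ^ (d - (m - j)))"

definition Phi :: "nat \<Rightarrow> nat \<Rightarrow> (nat \<Rightarrow> 'a::comm_ring_1) \<Rightarrow> (nat \<Rightarrow> 'a) \<Rightarrow> (nat \<Rightarrow> 'a)" where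
  "Phi d m t x = (\<lambda>i. if i = 0 then x 0 ^ d else homog_f d m t (x 0) (x i))"

end

(*
  Write M = max(1, |l_1|, ..., |l_m|) and M_n = max(1, |x_1|, ..., |x_m|) for the n-th iterate at one place.
  Since the c_i are distinct, the first iterate determines the parameters through a Vandermonde system
  depending on c only, so M_1 and M agree up to a bounded factor. Afterwards d > m makes the leading term
  x^d dominate as soon as M is large, so log M_n / d^n stays close to (log M) / d; if M is bounded, so is the
  limit. At a non-archimedean place where c and the inverse Vandermonde matrix are integral all of this is
  exact and there is no error. By the product formula only finitely many places are not of this kind, so
  averaging over the conjugates gives h(P) = h(l) / d + O(1). The same degree count over the function field
  gives the generic canonical height 1 / d.

  All heights in an orbit are computed over one common finite extension. This needs that an embedding of L
  over K has [L':K] / [L:K] extensions to L', which is proved by adjoining one generator at a time.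
*)

theory Submission
  imports Defs
begin

section \<open>Subalgebras and embeddings of the algebraic closure\<close>

text \<open>The obstacle is uniformity: the field generated by \<open>l\<close>, \<open>c\<close>
  and the inverse Vandermonde matrix grows with \<open>l\<close>, and so does the set of places that
  contribute to its height. A conjugate of a fixed number is a root of one monic polynomial over K,
  so at each place it is bounded in terms of that polynomial alone, whatever field and embedding
  produced it. The local error therefore depends on the place and on \<open>c\<close> only, and it
  vanishes outside a finite set of places fixed by \<open>c\<close>; the further places needed for
  the height of \<open>l\<close> contribute no error. Since as many embeddings are averaged as the
  degree says, a bound for each embedding is a bound for the mean.

  Number fields and function fields are treated alike through one property of their places: if |2| =
  1, then all integers have absolute value at most 1, which makes the place ultrametric. Places
  above 2 are simply counted among the finitely many exceptions.\<close>

definition K_subalgebra :: "'k::field alg_closure set \<Rightarrow> bool" where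
  "K_subalgebra L \<longleftrightarrow> range to_ac \<subseteq> L \<and> (\<forall>x\<in>L. \<forall>y\<in>L. x + y \<in> L \<and> x * y \<in> L)"

context
  fixes L :: "'k::field alg_closure set"
  assumes L: "K_subalgebra L"
begin

lemma K_subalgebra_to_ac: "to_ac k \<in> L"
  using L unfolding K_subalgebra_def by blast

lemma K_subalgebra_add: "x \<in> L \<Longrightarrow> y \<in> L \<Longrightarrow> x + y \<in> L"
  using L unfolding K_subalgebra_def by blast

lemma K_subalgebra_mult: "x \<in> L \<Longrightarrow> y \<in> L \<Longrightarrow> x * y \<in> L"
  using L unfolding K_subalgebra_def by blast

lemma K_subalgebra_0: "0 \<in> L" and K_subalgebra_1: "1 \<in> L"
  using K_subalgebra_to_ac[of 0] K_subalgebra_to_ac[of 1] by simp_all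

lemma K_subalgebra_uminus: "x \<in> L \<Longrightarrow> - x \<in> L"
  using K_subalgebra_mult[of "to_ac (- 1)" x] K_subalgebra_to_ac[of "- 1"] by simp

lemma K_subalgebra_diff: "x \<in> L \<Longrightarrow> y \<in> L \<Longrightarrow> x - y \<in> L"
  using K_subalgebra_add[of x "- y"] K_subalgebra_uminus[of y] by simp

lemma K_subalgebra_power: "x \<in> L \<Longrightarrow> x ^ n \<in> L"
  by (induction n) (auto intro: K_subalgebra_1 K_subalgebra_mult)

lemma K_subalgebra_sum: "(\<And>i. i \<in> I \<Longrightarrow> f i \<in> L) \<Longrightarrow> sum f I \<in> L"
  by (induction I rule: infinite_finite_induct) (auto intro: K_subalgebra_0 K_subalgebra_add)

lemmas K_subalgebra_closed = K_subalgebra_to_ac K_subalgebra_add K_subalgebra_mult K_subalgebra_0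
  K_subalgebra_1 K_subalgebra_uminus K_subalgebra_diff K_subalgebra_power K_subalgebra_sum

end

text \<open>If the constant coefficient of an annihilating polynomial vanishes, the factor X can be
  cancelled because \<open>x\<close> is nonzero. The nonzero constant later expresses the inverse of
  \<open>x\<close> as a polynomial in \<open>x\<close>.\<close>

lemma alg_closure_root_nonzero_const:
  fixes x :: "'k::field alg_closure"
  assumes "x \<noteq> 0"
  obtains p where "poly (map_poly to_ac p) x = 0" "Polynomial.coeff p 0 \<noteq> 0"
proof -
  have "\<exists>q. poly (map_poly to_ac q) x = 0 \<and> Polynomial.coeff q 0 \<noteq> 0"
    if "p \<noteq> 0" "poly (map_poly to_ac p) x = 0" for p
    using that
  proof (induction p)
    case 0
    then show ?case by simp
  next
    case (pCons a p)
    show ?case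
    proof (cases "a = 0")
      case True
      then show ?thesis using pCons assms by (simp add: map_poly_pCons)
    next
      case False
      then show ?thesis using pCons.prems by (intro exI[of _ "pCons a p"]) auto
    qed
  qed
  then show ?thesis using alg_closure_algebraic[of x] that by metis
qed

section \<open>Polynomials with coefficients in a subalgebra\<close>

definition poly_over :: "'a::zero set \<Rightarrow> 'a poly \<Rightarrow> bool" where
  "poly_over L p \<longleftrightarrow> (\<forall>i. Polynomial.coeff p i \<in> L)"

context
  fixes L :: "'k::field alg_closure set"
  assumes L: "K_subalgebra L"
begin

lemma poly_over_0: "poly_over L 0"
  by (simp add: poly_over_def K_subalgebra_0[OF L])

lemma poly_over_pCons: "poly_over L (pCons a p) \<longleftrightarrow> a \<in> L \<and> poly_over L p"
  unfolding poly_over_def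
  by (auto simp: coeff_pCons split: nat.split)

lemma poly_over_add: "poly_over L p \<Longrightarrow> poly_over L q \<Longrightarrow> poly_over L (p + q)"
  by (simp add: poly_over_def K_subalgebra_add[OF L])

lemma poly_over_diff: "poly_over L p \<Longrightarrow> poly_over L q \<Longrightarrow> poly_over L (p - q)"
  by (simp add: poly_over_def K_subalgebra_diff[OF L])

lemma poly_over_smult: "a \<in> L \<Longrightarrow> poly_over L p \<Longrightarrow> poly_over L (Polynomial.smult a p)"
  by (simp add: poly_over_def K_subalgebra_mult[OF L])

lemma poly_over_mult: "poly_over L p \<Longrightarrow> poly_over L q \<Longrightarrow> poly_over L (p * q)"
  unfolding poly_over_def coeff_mult by (auto intro!: K_subalgebra_sum[OF L] K_subalgebra_mult[OF L])

lemma poly_over_pderiv: "poly_over L p \<Longrightarrow> poly_over L (pderiv p)"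
  unfolding poly_over_def coeff_pderiv
  by (metis K_subalgebra_mult[OF L] K_subalgebra_to_ac[OF L] to_ac_of_nat)

lemma poly_over_map_to_ac: "poly_over L (map_poly to_ac p)"
  by (simp add: poly_over_def coeff_map_poly K_subalgebra_to_ac[OF L])

lemma poly_over_in: "poly_over L p \<Longrightarrow> x \<in> L \<Longrightarrow> poly p x \<in> L"
  unfolding poly_altdef poly_over_def
  by (auto intro!: K_subalgebra_sum[OF L] K_subalgebra_mult[OF L] K_subalgebra_power[OF L])

text \<open>A ring between \<open>K\<close> and its algebraic closure is a field because its elements are algebraic over \<open>K\<close>.\<close>

lemma K_subalgebra_inverse:
  assumes "x \<in> L"
  shows "inverse x \<in> L"
proof (cases "x = 0")
  case True
  then show ?thesis using assms by simp
next
  case False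
  from alg_closure_root_nonzero_const[OF this] obtain p
    where p: "poly (map_poly to_ac p) x = 0" "Polynomial.coeff p 0 \<noteq> 0" .
  obtain a q where pq: "p = pCons a q" by (cases p)
  have a: "to_ac a \<noteq> 0" using p(2) pq by simp
  have "p \<noteq> 0" using p(2) by auto
  then have eq: "to_ac a + x * poly (map_poly to_ac q) x = 0"
    using p(1) pq by (simp add: map_poly_pCons)
  then have "x * (- poly (map_poly to_ac q) x * to_ac (inverse a)) = 1"
    using a by (simp add: field_simps add_eq_0_iff2 neg_eq_iff_add_eq_0)
  then have "inverse x = - poly (map_poly to_ac q) x * to_ac (inverse a)"
    by (rule inverse_unique)
  then show ?thesis
    using poly_over_in[OF poly_over_map_to_ac assms, of q]
    by (simp add: K_subalgebra_closed[OF L] del: to_ac_inverse)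
qed

text \<open>The divisor is monic, so no coefficient is ever inverted and quotient and remainder stay
  over \<open>L\<close>.\<close>

lemma poly_over_division:
  assumes "poly_over L p" "Polynomial.lead_coeff p = 1" "poly_over L q" "Polynomial.degree p > 0"
  shows "\<exists>s r. poly_over L s \<and> poly_over L r \<and> q = s * p + r \<and> Polynomial.degree r < Polynomial.degree p"
  using assms(3)
proof (induction q)
  case 0
  then show ?case using assms poly_over_0 by (intro exI[of _ 0]) auto
next
  case (pCons a q)
  then obtain s r where sr: "poly_over L s" "poly_over L r" "q = s * p + r"
      "Polynomial.degree r < Polynomial.degree p"
    using poly_over_pCons by blast
  have a: "a \<in> L" using pCons.prems poly_over_pCons by blast
  define n where "n = Polynomial.degree p"
  \<comment> \<open>Prepending \<open>a\<close> raises the degree of the remainder to at most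
    \<open>n\<close>; \<open>c\<close> is the coefficient that must be cancelled in exactly that
    degree.\<close>
  define c where "c = Polynomial.coeff (pCons a r) n"
  define r' where "r' = pCons a r - Polynomial.smult c p"
  have c: "c \<in> L" and ar: "poly_over L (pCons a r)"
    using a sr(2) poly_over_pCons unfolding c_def poly_over_def by blast+
  have "Polynomial.degree r' < n"
  proof -
    have "Polynomial.degree (pCons a r) \<le> n" using sr(4) by (auto simp: n_def)
    then have "Polynomial.degree r' \<le> n" unfolding r'_def
      by (intro degree_diff_le) (auto simp: n_def)
    moreover have "Polynomial.coeff r' n = 0"
      using assms(2) unfolding r'_def c_def n_def by simp
    ultimately show ?thesis
      using assms(4) n_def by (metis leading_coeff_0_iff degree_0 le_neq_implies_less)
  qed
  moreover have "pCons a q = (pCons 0 s + [:c:]) * p + r'"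
    unfolding sr(3) r'_def by (simp add: algebra_simps)
  moreover have "poly_over L (pCons 0 s + [:c:])"
    using sr(1) c by (intro poly_over_add) (simp_all add: poly_over_pCons poly_over_0 K_subalgebra_0[OF L])
  moreover have "poly_over L r'"
    unfolding r'_def using assms(1) c ar by (intro poly_over_diff poly_over_smult)
  ultimately show ?case unfolding n_def by blast
qed

end

section \<open>Embeddings over K and their kernel polynomials\<close>

definition K_hom :: "'k::field alg_closure set \<Rightarrow> ('k alg_closure \<Rightarrow> 'k alg_closure) \<Rightarrow> bool" where
  "K_hom L \<sigma> \<longleftrightarrow> (\<forall>x\<in>L. \<forall>y\<in>L. \<sigma> (x + y) = \<sigma> x + \<sigma> y \<and> \<sigma> (x * y) = \<sigma> x * \<sigma> y) \<and>
     (\<forall>k. \<sigma> (to_ac k) = to_ac k)"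

text \<open>Preservation of 1 follows from fixing K. Extensionality is split off so that the
  identity and embeddings of larger fields also count as \<open>K_hom\<close> on
  \<open>L\<close>.\<close>

lemma K_embeddings_iff:
  assumes "K_subalgebra L"
  shows "\<sigma> \<in> K_embeddings L \<longleftrightarrow> \<sigma> \<in> extensional L \<and> K_hom L \<sigma>"
proof -
  have "\<sigma> \<in> ring_hom (sub_ring L) type_ring \<longleftrightarrow>
      (\<forall>x\<in>L. \<forall>y\<in>L. \<sigma> (x + y) = \<sigma> x + \<sigma> y \<and> \<sigma> (x * y) = \<sigma> x * \<sigma> y) \<and> \<sigma> 1 = 1"
    unfolding ring_hom_def ring_of_type_algebra_def by auto
  moreover have "(\<forall>k. \<sigma> (to_ac k) = to_ac k) \<Longrightarrow> \<sigma> 1 = 1"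
    using to_ac_1 by metis
  ultimately show ?thesis
    unfolding K_embeddings_def K_hom_def by blast
qed

lemma K_hom_subset: "K_hom L' \<sigma> \<Longrightarrow> L \<subseteq> L' \<Longrightarrow> K_hom L \<sigma>"
  unfolding K_hom_def by blast

lemma K_hom_id: "K_hom L (\<lambda>x. x)"
  by (simp add: K_hom_def)

lemma K_hom_cong: "K_hom L \<sigma> \<Longrightarrow> K_subalgebra L \<Longrightarrow> (\<And>x. x \<in> L \<Longrightarrow> \<tau> x = \<sigma> x) \<Longrightarrow> K_hom L \<tau>"
  unfolding K_hom_def using K_subalgebra_to_ac K_subalgebra_add K_subalgebra_mult by metis

text \<open>
  With \<open>\<sigma>\<close> the inclusion this is the minimal polynomial of \<open>\<beta>\<close> over \<open>L\<close>. Allowing any embedding \<open>\<sigma>\<close> makes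
  separability easy: a root of \<open>\<sigma> p\<close> inherits minimality, hence is not a root of the derivative.
\<close>

definition min_kernel_poly ::
    "'k::field alg_closure set \<Rightarrow> ('k alg_closure \<Rightarrow> 'k alg_closure) \<Rightarrow> 'k alg_closure \<Rightarrow>
     'k alg_closure poly \<Rightarrow> bool" where
  "min_kernel_poly L \<sigma> \<beta> p \<longleftrightarrow> poly_over L p \<and> Polynomial.lead_coeff p = 1 \<and> poly (map_poly \<sigma> p) \<beta> = 0 \<and>
     (\<forall>q. poly_over L q \<longrightarrow> q \<noteq> 0 \<longrightarrow> poly (map_poly \<sigma> q) \<beta> = 0 \<longrightarrow> Polynomial.degree p \<le> Polynomial.degree q)"

context
  fixes L :: "'k::field alg_closure set" and \<sigma>
  assumes L: "K_subalgebra L" and hom: "K_hom L \<sigma>"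
begin

lemma K_hom_add: "x \<in> L \<Longrightarrow> y \<in> L \<Longrightarrow> \<sigma> (x + y) = \<sigma> x + \<sigma> y"
  using hom by (simp add: K_hom_def)

lemma K_hom_mult: "x \<in> L \<Longrightarrow> y \<in> L \<Longrightarrow> \<sigma> (x * y) = \<sigma> x * \<sigma> y"
  using hom by (simp add: K_hom_def)

lemma K_hom_to_ac: "\<sigma> (to_ac k) = to_ac k"
  using hom by (simp add: K_hom_def)

lemma K_hom_0: "\<sigma> 0 = 0" and K_hom_1: "\<sigma> 1 = 1"
  using K_hom_to_ac[of 0] K_hom_to_ac[of 1] by simp_all

lemma K_hom_power: "x \<in> L \<Longrightarrow> \<sigma> (x ^ n) = \<sigma> x ^ n"
  by (induction n) (auto simp: K_hom_1 K_hom_mult K_subalgebra_power[OF L])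

lemma K_hom_sum: "(\<And>i. i \<in> I \<Longrightarrow> f i \<in> L) \<Longrightarrow> \<sigma> (sum f I) = (\<Sum>i\<in>I. \<sigma> (f i))"
  by (induction I rule: infinite_finite_induct)
    (auto simp: K_hom_0 K_hom_add K_subalgebra_sum[OF L])

text \<open>A nonzero element of \<open>L\<close> has its inverse in \<open>L\<close>, so
  \<open>\<sigma>\<close> cannot kill it.\<close>

lemma K_hom_eq_0_iff: "x \<in> L \<Longrightarrow> \<sigma> x = 0 \<longleftrightarrow> x = 0"
  by (metis K_hom_0 K_hom_1 K_hom_mult K_subalgebra_inverse[OF L] mult_zero_left right_inverse zero_neq_one)

lemma coeff_map_poly_K_hom: "Polynomial.coeff (map_poly \<sigma> p) i = \<sigma> (Polynomial.coeff p i)"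
  by (simp add: coeff_map_poly K_hom_0)

lemma map_poly_K_hom_add:
  "poly_over L p \<Longrightarrow> poly_over L q \<Longrightarrow> map_poly \<sigma> (p + q) = map_poly \<sigma> p + map_poly \<sigma> q"
  by (rule poly_eqI) (simp add: coeff_map_poly_K_hom poly_over_def K_hom_add)

lemma map_poly_K_hom_mult:
  "poly_over L p \<Longrightarrow> poly_over L q \<Longrightarrow> map_poly \<sigma> (p * q) = map_poly \<sigma> p * map_poly \<sigma> q"
proof (rule poly_eqI)
  fix n
  assume "poly_over L p" "poly_over L q"
  then have "\<sigma> (\<Sum>i\<le>n. Polynomial.coeff p i * Polynomial.coeff q (n - i)) =
      (\<Sum>i\<le>n. \<sigma> (Polynomial.coeff p i) * \<sigma> (Polynomial.coeff q (n - i)))"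
    by (subst K_hom_sum) (auto simp: poly_over_def K_hom_mult K_subalgebra_mult[OF L])
  then show "Polynomial.coeff (map_poly \<sigma> (p * q)) n = Polynomial.coeff (map_poly \<sigma> p * map_poly \<sigma> q) n"
    by (simp add: coeff_map_poly_K_hom coeff_mult)
qed

lemma degree_map_poly_K_hom:
  assumes "poly_over L p"
  shows "Polynomial.degree (map_poly \<sigma> p) = Polynomial.degree p"
  using assms unfolding Polynomial.degree_def coeff_map_poly_K_hom poly_over_def
  by (simp add: K_hom_eq_0_iff)

lemma map_poly_K_hom_pderiv:
  assumes "poly_over L p"
  shows "map_poly \<sigma> (pderiv p) = pderiv (map_poly \<sigma> p)"
proof (rule poly_eqI)
  fix i
  have "\<sigma> (of_nat (Suc i)) = of_nat (Suc i)"
    using K_hom_to_ac[of "of_nat (Suc i)"] unfolding to_ac_of_nat .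
  then show "Polynomial.coeff (map_poly \<sigma> (pderiv p)) i = Polynomial.coeff (pderiv (map_poly \<sigma> p)) i"
    using assms K_subalgebra_to_ac[OF L, of "of_nat (Suc i)"]
    by (simp add: coeff_map_poly_K_hom coeff_pderiv poly_over_def K_hom_mult del: of_nat_Suc)
qed

text \<open>A polynomial over K annihilating \<open>\<beta>\<close> is fixed by
  \<open>\<sigma>\<close>, so the kernel contains a nonzero polynomial; one of least degree is made
  monic by an inverse taken in \<open>L\<close>.\<close>

lemma min_kernel_poly_exists: "\<exists>p. min_kernel_poly L \<sigma> \<beta> p"
proof -
  define Q where "Q q \<longleftrightarrow> poly_over L q \<and> q \<noteq> 0 \<and> poly (map_poly \<sigma> q) \<beta> = 0" for q
  obtain p :: "'k poly" where p: "p \<noteq> 0" "poly (map_poly to_ac p) \<beta> = 0"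
    using alg_closure_algebraic by blast
  have "map_poly \<sigma> (map_poly to_ac p) = map_poly to_ac p"
    by (rule poly_eqI) (simp add: coeff_map_poly_K_hom coeff_map_poly K_hom_to_ac)
  moreover have "map_poly to_ac p \<noteq> 0"
    using p(1) by (metis coeff_0 coeff_map_poly poly_eqI to_ac_0 to_ac_eq_0_iff)
  ultimately have "Q (map_poly to_ac p)"
    using p by (simp add: Q_def poly_over_map_to_ac[OF L])
  then obtain q where q: "Q q" and min: "\<And>r. Q r \<Longrightarrow> Polynomial.degree q \<le> Polynomial.degree r"
    using exists_least_iff[of "\<lambda>n. \<exists>q. Q q \<and> Polynomial.degree q = n"] by (metis not_le_imp_less)
  define a where "a = inverse (Polynomial.lead_coeff q)"
  have a: "a \<in> L" "a \<noteq> 0" using q unfolding a_def Q_def poly_over_def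
    by (auto intro: K_subalgebra_inverse[OF L])
  have pa: "poly_over L [:a:]" using a by (simp add: poly_over_pCons[OF L] poly_over_0[OF L])
  have "poly (map_poly \<sigma> (Polynomial.smult a q)) \<beta> = 0"
    using map_poly_K_hom_mult[OF pa, of q] q by (simp add: Q_def)
  moreover have "poly_over L (Polynomial.smult a q)"
    using poly_over_mult[OF L pa, of q] q by (simp add: Q_def)
  ultimately have "min_kernel_poly L \<sigma> \<beta> (Polynomial.smult a q)"
    using min a q unfolding min_kernel_poly_def Q_def by (auto simp: a_def)
  then show ?thesis by blast
qed

lemma min_kernel_poly_degree_pos: "min_kernel_poly L \<sigma> \<beta> p \<Longrightarrow> Polynomial.degree p > 0"
proof (rule ccontr)
  assume p: "min_kernel_poly L \<sigma> \<beta> p" and "\<not> Polynomial.degree p > 0"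
  then have "p = 1"
    unfolding min_kernel_poly_def by (metis degree_0_id gr0I of_nat_1 one_pCons)
  then show False using p K_hom_1 K_hom_0 unfolding min_kernel_poly_def
    by (simp add: map_poly_1')
qed

lemma min_kernel_poly_dvd:
  assumes "min_kernel_poly L \<sigma> \<beta> p" "poly_over L q" "poly (map_poly \<sigma> q) \<beta> = 0"
  shows "\<exists>s. poly_over L s \<and> q = s * p"
proof -
  have p: "poly_over L p" "Polynomial.lead_coeff p = 1" "poly (map_poly \<sigma> p) \<beta> = 0"
    using assms(1) by (auto simp: min_kernel_poly_def)
  obtain s r where sr: "poly_over L s" "poly_over L r" "q = s * p + r"
      "Polynomial.degree r < Polynomial.degree p"
    using poly_over_division[OF L p(1,2) assms(2) min_kernel_poly_degree_pos[OF assms(1)]] by blast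
  have "poly (map_poly \<sigma> r) \<beta> = 0"
    using assms(3) p(3) sr(1-3) p(1)
    by (simp add: map_poly_K_hom_add map_poly_K_hom_mult poly_over_mult[OF L])
  then have "r = 0" using assms(1) sr(2,4) unfolding min_kernel_poly_def by force
  then show ?thesis using sr by auto
qed

end

lemma map_poly_ident: "map_poly (\<lambda>x. x) p = p"
  by (rule poly_eqI) (simp add: coeff_map_poly)

context
  fixes L :: "'k::field_char_0 alg_closure set" and a p
  assumes L: "K_subalgebra L" and p: "min_kernel_poly L (\<lambda>x. x) a p"
begin

text \<open>The kernel polynomial \<open>g\<close> of \<open>\<beta>\<close> divides
  \<open>p = s * g\<close>. As \<open>a\<close> is a root of \<open>s\<close> or of
  \<open>g\<close>, minimality at \<open>a\<close> gives that factor the full degree. It cannot be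
  \<open>s\<close>, because \<open>g\<close> is not constant; hence \<open>s\<close> is constant and
  monic.\<close>

lemma min_poly_transfer:
  assumes "K_hom L \<sigma>" "poly (map_poly \<sigma> p) \<beta> = 0"
  shows "min_kernel_poly L \<sigma> \<beta> p"
proof -
  note id = K_hom_id[of L]
  have pL: "poly_over L p" "Polynomial.lead_coeff p = 1" "poly p a = 0"
    using p by (auto simp: min_kernel_poly_def map_poly_ident)
  obtain g where g: "min_kernel_poly L \<sigma> \<beta> g"
    using min_kernel_poly_exists[OF L assms(1)] by blast
  obtain s where s: "poly_over L s" "p = s * g"
    using min_kernel_poly_dvd[OF L assms(1) g pL(1) assms(2)] by blast
  have gL: "poly_over L g" "Polynomial.lead_coeff g = 1" using g
    by (auto simp: min_kernel_poly_def)
  have nz: "s \<noteq> 0" "g \<noteq> 0" using pL(2) s(2) by auto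
  have deg: "Polynomial.degree p = Polynomial.degree s + Polynomial.degree g"
    using s(2) nz degree_mult_eq by blast
  have "poly s a = 0 \<or> poly g a = 0" using pL(3) s(2) by simp
  then have "Polynomial.degree p \<le> Polynomial.degree s \<or> Polynomial.degree p \<le> Polynomial.degree g"
    using p nz s(1) gL(1) unfolding min_kernel_poly_def map_poly_ident by blast
  then have "Polynomial.degree s = 0"
    using deg min_kernel_poly_degree_pos[OF L assms(1) g] by linarith
  moreover have "Polynomial.lead_coeff s = 1"
    using s(2) pL(2) gL(2) by (metis lead_coeff_mult mult.right_neutral)
  ultimately have "s = 1" by (metis degree_0_id one_pCons)
  then show ?thesis using g s(2) by simp
qed

text \<open>All roots are simple: \<open>p\<close> is minimal at each of them, while its derivative
  has smaller degree and, in characteristic 0, is nonzero.\<close>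

lemma card_roots_min_poly:
  assumes "K_hom L \<sigma>"
  shows "card {\<beta>. poly (map_poly \<sigma> p) \<beta> = 0} = Polynomial.degree p"
proof -
  note id = K_hom_id[of L]
  have pL: "poly_over L p" "Polynomial.lead_coeff p = 1"
    using p by (auto simp: min_kernel_poly_def)
  define f where "f = map_poly \<sigma> p"
  have deg: "Polynomial.degree f = Polynomial.degree p"
    unfolding f_def by (rule degree_map_poly_K_hom[OF L assms pL(1)])
  have pos: "Polynomial.degree p > 0" by (rule min_kernel_poly_degree_pos[OF L id p])
  then have "f \<noteq> 0" using deg by auto
  have "\<not> (poly f b = 0 \<and> poly (pderiv f) b = 0)" for b
  proof
    assume b: "poly f b = 0 \<and> poly (pderiv f) b = 0"
    have "min_kernel_poly L \<sigma> b p" using b by (intro min_poly_transfer[OF assms]) (simp add: f_def)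
    moreover have "poly_over L (pderiv p)" by (rule poly_over_pderiv[OF L pL(1)])
    moreover have "poly (map_poly \<sigma> (pderiv p)) b = 0"
      using b map_poly_K_hom_pderiv[OF L assms pL(1)] by (simp add: f_def)
    moreover have "Polynomial.degree (pderiv p) < Polynomial.degree p" "pderiv p \<noteq> 0"
      using pos by (auto simp: degree_pderiv pderiv_eq_0_iff)
    ultimately show False unfolding min_kernel_poly_def by force
  qed
  then have "rsquarefree f" by (simp add: rsquarefree_roots)
  obtain A where A: "size A = Polynomial.degree f"
      "f = Polynomial.smult (Polynomial.lead_coeff f) (\<Prod>x\<in>#A. [:- x, 1:])"
    using alg_closed_imp_factorization[OF \<open>f \<noteq> 0\<close>] by blast
  \<comment> \<open>The factorization lists the roots with multiplicity; identifying
    \<open>A\<close> with \<open>proots f\<close> lets squarefreeness turn this multiset into a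
    set.\<close>
  have "proots f = proots (\<Prod>x\<in>#A. [:- x, 1:])"
    using A(2) \<open>f \<noteq> 0\<close> by (metis proots_smult smult_0_left)
  also have "\<dots> = A"
  proof (induction A)
    case (add x A)
    have "(\<Prod>x\<in>#A. [:- x, 1:]) \<noteq> 0" by auto
    then have "proots ([:- x, 1:] * (\<Prod>x\<in>#A. [:- x, 1:])) = add_mset x A"
      by (subst proots_mult) (use add.IH in simp_all)
    then show ?case by (simp only: image_mset_add_mset prod_mset.add_mset)
  qed simp
  finally have prA: "proots f = A" .
  have "card {\<beta>. poly f \<beta> = 0} = card (set_mset A)"
    using \<open>f \<noteq> 0\<close> prA by (metis set_count_proots)
  also have "\<dots> = size A"
  proof -
    have "count A x = (if x \<in># A then 1 else 0)" for x
      using \<open>rsquarefree f\<close> prA \<open>f \<noteq> 0\<close>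
      by (metis count_proots count_eq_zero_iff rsquarefree_def)
    then have "A = mset_set (set_mset A)"
      by (intro multiset_eqI) (simp add: count_mset_set')
    then show ?thesis by (metis size_mset_set)
  qed
  finally show ?thesis using A(1) deg by (simp add: f_def)
qed

end

lemma K_hom_poly:
  assumes "K_subalgebra L" "K_hom L \<sigma>" "poly_over L q" "a \<in> L"
  shows "\<sigma> (poly q a) = poly (map_poly \<sigma> q) (\<sigma> a)"
  using assms(3)
proof (induction q)
  case 0
  then show ?case by (simp add: K_hom_0[OF assms(1,2)])
next
  case (pCons c q)
  then have "c \<in> L" "poly_over L q" by (simp_all add: poly_over_pCons[OF assms(1)])
  then show ?case using pCons
    by (simp add: map_poly_pCons K_hom_0[OF assms(1,2)] K_hom_add[OF assms(1,2)] K_hom_mult[OF assms(1,2)]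
        K_subalgebra_mult[OF assms(1)] poly_over_in[OF assms(1)] assms(4))
qed

section \<open>Counting the extensions of an embedding\<close>

definition adjoin :: "'k::field alg_closure set \<Rightarrow> 'k alg_closure \<Rightarrow> 'k alg_closure set" where
  "adjoin L a = {poly q a |q. poly_over L q}"

lemma adjoin_extends:
  assumes "K_subalgebra L"
  shows "L \<subseteq> adjoin L a" and "a \<in> adjoin L a"
proof -
  have "x = poly [:x:] a" "x \<in> L \<Longrightarrow> poly_over L [:x:]" for x
    by (simp_all add: poly_over_pCons[OF assms] poly_over_0[OF assms])
  then show "L \<subseteq> adjoin L a" unfolding adjoin_def by blast
  have "a = poly [:0, 1:] a" "poly_over L [:0, 1:]"
    by (simp_all add: poly_over_pCons[OF assms] poly_over_0[OF assms] K_subalgebra_0[OF assms]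
        K_subalgebra_1[OF assms])
  then show "a \<in> adjoin L a" unfolding adjoin_def by blast
qed

lemma K_subalgebra_adjoin:
  assumes "K_subalgebra L"
  shows "K_subalgebra (adjoin L a)"
proof -
  have "x + y \<in> adjoin L a \<and> x * y \<in> adjoin L a" if xy: "x \<in> adjoin L a" "y \<in> adjoin L a" for x y
  proof -
    obtain p q where "x = poly p a" "poly_over L p" "y = poly q a" "poly_over L q"
      using xy unfolding adjoin_def by blast
    then have "x + y = poly (p + q) a" "poly_over L (p + q)" "x * y = poly (p * q) a" "poly_over L (p * q)"
      using poly_over_add[OF assms] poly_over_mult[OF assms] by auto
    then show ?thesis unfolding adjoin_def by blast
  qed
  then show ?thesis
    using adjoin_extends(1)[OF assms, of a] assms unfolding K_subalgebra_def by blast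
qed

lemma adjoin_least:
  assumes "K_subalgebra L'" "L \<subseteq> L'" "a \<in> L'"
  shows "adjoin L a \<subseteq> L'"
  using poly_over_in[OF assms(1) _ assms(3)] assms(2) unfolding adjoin_def poly_over_def by blast

definition K_extensions ::
    "'k::field alg_closure set \<Rightarrow> 'k alg_closure set \<Rightarrow> ('k alg_closure \<Rightarrow> 'k alg_closure) \<Rightarrow>
     ('k alg_closure \<Rightarrow> 'k alg_closure) set" where
  "K_extensions L L' \<sigma> = {\<tau> \<in> K_embeddings L'. restrict \<tau> L = \<sigma>}"

text \<open>\<open>n\<close> stands for the relative degree of \<open>L'\<close> over
  \<open>L\<close>. Requiring \<open>n > 0\<close> also makes the sets of extensions finite, since
  an infinite set has cardinality 0.\<close>

definition uniform_extension :: "'k::field alg_closure set \<Rightarrow> 'k alg_closure set \<Rightarrow> nat \<Rightarrow> bool" where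
  "uniform_extension L L' n \<longleftrightarrow> L \<subseteq> L' \<and> n > 0 \<and> (\<forall>\<sigma>\<in>K_embeddings L. card (K_extensions L L' \<sigma>) = n)"

lemma restrict_K_embedding:
  assumes "K_subalgebra L" "K_subalgebra L'" "L \<subseteq> L'" "\<sigma> \<in> K_embeddings L'"
  shows "restrict \<sigma> L \<in> K_embeddings L"
  using assms K_hom_cong[OF K_hom_subset[of L' \<sigma> L] assms(1), of "restrict \<sigma> L"]
  by (simp add: K_embeddings_iff)

lemma map_poly_cong_on:
  assumes "poly_over L q" "\<And>x. x \<in> L \<Longrightarrow> f x = g x" "0 \<in> L" "g 0 = 0"
  shows "map_poly f q = map_poly g q"
  using assms by (intro poly_eqI) (simp add: coeff_map_poly poly_over_def)

text \<open>An extension is determined by its value at \<open>a\<close>, and the possible values are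
  exactly the roots of the image of \<open>p\<close> under \<open>\<sigma>\<close>.\<close>

lemma card_K_extensions_adjoin:
  fixes L :: "'k::field_char_0 alg_closure set"
  assumes L: "K_subalgebra L" and p: "min_kernel_poly L (\<lambda>x. x) a p" and \<sigma>: "\<sigma> \<in> K_embeddings L"
  shows "card (K_extensions L (adjoin L a) \<sigma>) = Polynomial.degree p"
proof -
  let ?A = "adjoin L a"
  note A = K_subalgebra_adjoin[OF L, of a]
  have hom: "K_hom L \<sigma>" and ext: "\<sigma> \<in> extensional L" using \<sigma> K_embeddings_iff[OF L] by auto
  note id = K_hom_id[of L]
  have pL: "poly_over L p" "poly p a = 0"
    using p by (auto simp: min_kernel_poly_def map_poly_ident)
  have ev: "\<tau> (poly q a) = poly (map_poly \<sigma> q) (\<tau> a)"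
    if \<tau>: "\<tau> \<in> K_extensions L ?A \<sigma>" and q: "poly_over L q" for \<tau> q
  proof -
    have \<tau>A: "K_hom ?A \<tau>" "restrict \<tau> L = \<sigma>" using \<tau> K_embeddings_iff[OF A] by (auto simp: K_extensions_def)
    have qA: "poly_over ?A q" using q adjoin_extends(1)[OF L, of a] by (auto simp: poly_over_def)
    have "map_poly \<tau> q = map_poly \<sigma> q"
      using \<tau>A(2) K_hom_0[OF L hom] K_subalgebra_0[OF L]
      by (intro map_poly_cong_on[OF q]) auto
    then show ?thesis using K_hom_poly[OF A \<tau>A(1) qA adjoin_extends(2)[OF L]] by simp
  qed
  have "inj_on (\<lambda>\<tau>. \<tau> a) (K_extensions L ?A \<sigma>)"
  proof (rule inj_onI)
    fix \<tau> \<tau>' assume *: "\<tau> \<in> K_extensions L ?A \<sigma>" "\<tau>' \<in> K_extensions L ?A \<sigma>" "\<tau> a = \<tau>' a"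
    show "\<tau> = \<tau>'"
    proof (rule extensionalityI[of _ ?A])
      show "\<tau> \<in> extensional ?A" "\<tau>' \<in> extensional ?A"
        using * K_embeddings_iff[OF A] by (auto simp: K_extensions_def)
      fix x assume "x \<in> ?A"
      then obtain q where q: "poly_over L q" "x = poly q a" by (auto simp: adjoin_def)
      show "\<tau> x = \<tau>' x" unfolding q(2) ev[OF *(1) q(1)] ev[OF *(2) q(1)] *(3) ..
    qed
  qed
  moreover have "(\<lambda>\<tau>. \<tau> a) ` K_extensions L ?A \<sigma> = {\<beta>. poly (map_poly \<sigma> p) \<beta> = 0}"
  proof (intro equalityI subsetI)
    fix \<beta> assume "\<beta> \<in> (\<lambda>\<tau>. \<tau> a) ` K_extensions L ?A \<sigma>"
    then obtain \<tau> where \<tau>: "\<tau> \<in> K_extensions L ?A \<sigma>" "\<beta> = \<tau> a" by blast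
    then have "poly (map_poly \<sigma> p) \<beta> = \<tau> (poly p a)" using ev pL by simp
    also have "\<dots> = 0" using \<tau> pL(2) K_embeddings_iff[OF A] K_hom_0[OF A] by (auto simp: K_extensions_def)
    finally show "\<beta> \<in> {\<beta>. poly (map_poly \<sigma> p) \<beta> = 0}" by simp
  next
    fix \<beta> assume "\<beta> \<in> {\<beta>. poly (map_poly \<sigma> p) \<beta> = 0}"
    then have \<beta>: "poly (map_poly \<sigma> p) \<beta> = 0" by simp
    \<comment> \<open>An element of \<open>adjoin L a\<close> is represented by some polynomial over
      \<open>L\<close>, which is moved by \<open>\<sigma>\<close> and evaluated at
      \<open>\<beta>\<close>.\<close>
    define \<tau> where "\<tau> = restrict (\<lambda>z. poly (map_poly \<sigma> (SOME q. poly_over L q \<and> poly q a = z)) \<beta>) ?A"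
    \<comment> \<open>The choice of representative is immaterial: two of them differ by a multiple
      of \<open>p\<close>, whose image under \<open>\<sigma>\<close> vanishes at
      \<open>\<beta>\<close>.\<close>
    have \<tau>: "\<tau> (poly q a) = poly (map_poly \<sigma> q) \<beta>" if q: "poly_over L q" for q
    proof -
      define r where "r = (SOME r. poly_over L r \<and> poly r a = poly q a)"
      have r: "poly_over L r" "poly r a = poly q a"
        using someI[of "\<lambda>r. poly_over L r \<and> poly r a = poly q a" q] q unfolding r_def by auto
      have "poly (map_poly (\<lambda>x. x) (q - r)) a = 0" using r by (simp add: map_poly_ident)
      from min_kernel_poly_dvd[OF L id p poly_over_diff[OF L q r(1)] this]
      obtain s where s: "poly_over L s" "q - r = s * p" by blast
      then have "q = s * p + r" by (simp add: algebra_simps)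
      then have "poly (map_poly \<sigma> q) \<beta> = poly (map_poly \<sigma> r) \<beta>"
        using \<beta> s(1) pL(1) r(1) by (simp add: map_poly_K_hom_add[OF L hom] map_poly_K_hom_mult[OF L hom] poly_over_mult[OF L])
      moreover have "poly q a \<in> ?A" using q by (auto simp: adjoin_def)
      ultimately show ?thesis by (simp add: \<tau>_def r_def)
    qed
    have \<tau>L: "\<tau> x = \<sigma> x" if "x \<in> L" for x
      using \<tau>[of "[:x:]"] that K_hom_0[OF L hom]
      by (simp add: poly_over_pCons[OF L] poly_over_0[OF L] map_poly_pCons)
    have "K_hom ?A \<tau>"
    proof -
      have "\<tau> (x + y) = \<tau> x + \<tau> y \<and> \<tau> (x * y) = \<tau> x * \<tau> y" if "x \<in> ?A" "y \<in> ?A" for x y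
      proof -
        obtain q r where qr: "x = poly q a" "poly_over L q" "y = poly r a" "poly_over L r"
          using \<open>x \<in> ?A\<close> \<open>y \<in> ?A\<close> unfolding adjoin_def by blast
        then have "x + y = poly (q + r) a" "x * y = poly (q * r) a" by simp_all
        moreover have "\<tau> (poly (q + r) a) = \<tau> x + \<tau> y" "\<tau> (poly (q * r) a) = \<tau> x * \<tau> y"
          using qr \<tau>[of q] \<tau>[of r] \<tau>[OF poly_over_add[OF L qr(2,4)]] \<tau>[OF poly_over_mult[OF L qr(2,4)]]
          by (simp_all add: map_poly_K_hom_add[OF L hom] map_poly_K_hom_mult[OF L hom])
        ultimately show ?thesis by simp
      qed
      then show ?thesis
        unfolding K_hom_def using \<tau>L K_subalgebra_to_ac[OF L] K_hom_to_ac[OF L hom] by simp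
    qed
    moreover have "restrict \<tau> L = \<sigma>"
      using \<tau>L ext by (intro extensionalityI[of _ L]) auto
    moreover have "\<tau> \<in> extensional ?A" unfolding \<tau>_def by simp
    ultimately have "\<tau> \<in> K_extensions L ?A \<sigma>" by (simp add: K_extensions_def K_embeddings_iff[OF A])
    moreover have "\<tau> a = \<beta>"
      using \<tau>[of "[:0, 1:]"] K_hom_0[OF L hom] K_hom_1[OF L hom]
      by (simp add: poly_over_pCons[OF L] poly_over_0[OF L] map_poly_pCons K_subalgebra_0[OF L] K_subalgebra_1[OF L])
    ultimately show "\<beta> \<in> (\<lambda>\<tau>. \<tau> a) ` K_extensions L ?A \<sigma>" by blast
  qed
  ultimately have "card (K_extensions L ?A \<sigma>) = card {\<beta>. poly (map_poly \<sigma> p) \<beta> = 0}"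
    using card_image by fastforce
  then show ?thesis using card_roots_min_poly[OF L p hom] by simp
qed

text \<open>Extensions to the top field are sorted by their restriction to the middle field, which
  is itself an extension of \<open>\<sigma>\<close>.\<close>

lemma uniform_extension_trans:
  assumes L: "K_subalgebra L" "K_subalgebra L'" "K_subalgebra L''"
    and ext: "uniform_extension L L' n" "uniform_extension L' L'' k"
  shows "uniform_extension L L'' (k * n)"
proof -
  have sub: "L \<subseteq> L'" "L' \<subseteq> L''" and pos: "n > 0" "k > 0" using ext by (auto simp: uniform_extension_def)
  have "card (K_extensions L L'' \<sigma>) = k * n" if \<sigma>: "\<sigma> \<in> K_embeddings L" for \<sigma>
  proof -
    have c1: "card (K_extensions L L' \<sigma>) = n" using ext(1) \<sigma> by (simp add: uniform_extension_def)
    have c2: "card (K_extensions L' L'' \<tau>) = k" if "\<tau> \<in> K_extensions L L' \<sigma>" for \<tau>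
      using ext(2) that by (simp add: uniform_extension_def K_extensions_def)
    have "K_extensions L L'' \<sigma> = (\<Union>\<tau>\<in>K_extensions L L' \<sigma>. K_extensions L' L'' \<tau>)"
      using restrict_K_embedding[OF L(2,3) sub(2)] sub by (auto simp: K_extensions_def Int_absorb1)
    also have "card \<dots> = (\<Sum>\<tau>\<in>K_extensions L L' \<sigma>. card (K_extensions L' L'' \<tau>))"
    proof (rule card_UN_disjoint)
      show "finite (K_extensions L L' \<sigma>)" using c1 pos by (metis card.infinite less_irrefl)
      show "\<forall>\<tau>\<in>K_extensions L L' \<sigma>. finite (K_extensions L' L'' \<tau>)"
        using c2 pos by (metis card.infinite less_irrefl)
    qed (auto simp: K_extensions_def)
    also have "\<dots> = k * n" using c1 c2 by simp
    finally show ?thesis .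
  qed
  then show ?thesis using sub pos by (auto simp: uniform_extension_def)
qed

section \<open>Bases and degrees over K\<close>

definition K_basis :: "'k::field alg_closure set \<Rightarrow> 'k alg_closure set \<Rightarrow> bool" where
  "K_basis B L \<longleftrightarrow> finite B \<and> (\<forall>u. (\<Sum>b\<in>B. to_ac (u b) * b) = 0 \<longrightarrow> (\<forall>b\<in>B. u b = 0)) \<and>
     L = range (\<lambda>u. \<Sum>b\<in>B. to_ac (u b) * b)"

lemma vector_space_alg_closure: "vector_space (\<lambda>(k::'k::field) x. to_ac k * x)"
  by standard (simp_all add: algebra_simps)

lemma ext_degree_K_basis:
  assumes "K_basis B L"
  shows "ext_degree L = card B"
proof -
  interpret vs: vector_space "\<lambda>(k::'k::field) x. to_ac k * x" by (rule vector_space_alg_closure)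
  have fin: "finite B" using assms by (simp add: K_basis_def)
  have "vs.independent B"
    using assms fin by (auto simp: vs.dependent_finite K_basis_def)
  moreover have "vs.span B = L"
    using assms fin by (simp add: vs.span_finite K_basis_def)
  ultimately show ?thesis
    unfolding ext_degree_def using vs.dim_span_eq_card_independent[of B] by simp
qed

text \<open>Indexed families suit products of bases. Independence makes \<open>g\<close> injective,
  since two equal values would satisfy the relation with coefficients 1 and -1.\<close>

lemma K_basis_image:
  fixes g :: "'i \<Rightarrow> 'k::field alg_closure"
  assumes fin: "finite I"
    and indep: "\<And>u. (\<Sum>x\<in>I. to_ac (u x) * g x) = 0 \<Longrightarrow> \<forall>x\<in>I. u x = 0"
    and span: "L = range (\<lambda>u. \<Sum>x\<in>I. to_ac (u x) * g x)"
  shows "K_basis (g ` I) L \<and> card (g ` I) = card I"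
proof -
  have inj: "inj_on g I"
  proof (rule inj_onI, rule ccontr)
    fix x y assume xy: "x \<in> I" "y \<in> I" "g x = g y" "x \<noteq> y"
    define u :: "'i \<Rightarrow> 'k" where "u z = (if z = x then 1 else if z = y then - 1 else 0)" for z
    have "(\<Sum>z\<in>I. to_ac (u z) * g z) = (\<Sum>z\<in>{x, y}. to_ac (u z) * g z)"
      using xy fin by (intro sum.mono_neutral_right) (auto simp: u_def)
    also have "\<dots> = 0" using xy by (simp add: u_def)
    finally have "u x = 0" using indep xy by blast
    then show False by (simp add: u_def)
  qed
  have reindex: "(\<Sum>b\<in>g ` I. to_ac (u b) * b) = (\<Sum>x\<in>I. to_ac (u (g x)) * g x)" for u
    by (subst sum.reindex[OF inj]) simp
  have "range (\<lambda>u. \<Sum>x\<in>I. to_ac (u x) * g x) = range (\<lambda>u. \<Sum>b\<in>g ` I. to_ac (u b) * b)"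
  proof (intro equalityI subsetI)
    fix z assume "z \<in> range (\<lambda>u. \<Sum>x\<in>I. to_ac (u x) * g x)"
    then obtain u where "z = (\<Sum>x\<in>I. to_ac (u x) * g x)" by blast
    then have "z = (\<Sum>b\<in>g ` I. to_ac (u (inv_into I g b)) * b)"
      unfolding reindex by (simp add: inv_into_f_f[OF inj])
    then show "z \<in> range (\<lambda>u. \<Sum>b\<in>g ` I. to_ac (u b) * b)"
      by (intro image_eqI[where x = "\<lambda>b. u (inv_into I g b)"]) simp_all
  qed (auto simp: reindex)
  moreover have "\<forall>b\<in>g ` I. u b = 0" if "(\<Sum>b\<in>g ` I. to_ac (u b) * b) = 0" for u
    using indep[of "u \<circ> g"] that by (simp add: reindex)
  ultimately show ?thesis
    using fin span card_image[OF inj] unfolding K_basis_def by auto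
qed

text \<open>This is the multiplicativity of degrees: the basis consists of the elements of
  \<open>B\<close> times the powers of \<open>a\<close> below the degree of
  \<open>p\<close>.\<close>

lemma K_basis_adjoin:
  fixes L :: "'k::field_char_0 alg_closure set"
  assumes L: "K_subalgebra L" and p: "min_kernel_poly L (\<lambda>x. x) a p" and B: "K_basis B L"
  shows "\<exists>B'. K_basis B' (adjoin L a) \<and> card B' = Polynomial.degree p * card B"
proof -
  note id = K_hom_id[of L]
  define n where "n = Polynomial.degree p"
  have pL: "poly_over L p" "Polynomial.lead_coeff p = 1" "poly p a = 0"
    and min': "\<forall>q. poly_over L q \<longrightarrow> q \<noteq> 0 \<longrightarrow> poly q a = 0 \<longrightarrow> n \<le> Polynomial.degree q"
    using p unfolding min_kernel_poly_def map_poly_ident n_def by blast+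
  have min: "q = 0" if "poly_over L q" "poly q a = 0" "Polynomial.degree q < n" for q
    using min' that by (metis not_le)
  have npos: "n > 0" using min_kernel_poly_degree_pos[OF L id p] by (simp add: n_def)
  have fin: "finite B" and Bind: "\<And>u. (\<Sum>b\<in>B. to_ac (u b) * b) = 0 \<Longrightarrow> \<forall>b\<in>B. u b = 0"
    and Bspan: "L = range (\<lambda>u. \<Sum>b\<in>B. to_ac (u b) * b)" using B by (auto simp: K_basis_def)
  define g where "g x = snd x * a ^ fst x" for x
  \<comment> \<open>The coordinates are packed into one polynomial over \<open>L\<close> of degree
    below \<open>n\<close>, so a linear relation becomes a polynomial too short to vanish at
    \<open>a\<close> unless it is zero.\<close>
  define q where "q u = Poly (map (\<lambda>i. \<Sum>b\<in>B. to_ac (u (i, b)) * b) [0..<n])" for u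
  have coeff_q: "Polynomial.coeff (q u) i = (if i < n then \<Sum>b\<in>B. to_ac (u (i, b)) * b else 0)" for u i
    by (simp add: q_def nth_default_def)
  have qL: "poly_over L (q u)" for u
    using Bspan K_subalgebra_0[OF L] by (auto simp: poly_over_def coeff_q)
  have qdeg: "Polynomial.degree (q u) < n" for u
    using npos by (intro le_less_trans[OF degree_le[of "n - 1"]]) (auto simp: coeff_q)
  have "poly (q u) a = (\<Sum>i<n. Polynomial.coeff (q u) i * a ^ i)" for u
    unfolding poly_altdef using qdeg[of u]
    by (intro sum.mono_neutral_left) (auto simp: coeff_eq_0)
  also have "\<And>u. (\<Sum>i<n. Polynomial.coeff (q u) i * a ^ i) = (\<Sum>i<n. \<Sum>b\<in>B. to_ac (u (i, b)) * g (i, b))"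
    by (simp add: coeff_q g_def sum_distrib_left sum_distrib_right mult_ac)
  also have "\<And>u. (\<Sum>i<n. \<Sum>b\<in>B. to_ac (u (i, b)) * g (i, b)) = (\<Sum>x\<in>{..<n} \<times> B. to_ac (u x) * g x)"
    by (simp add: sum.cartesian_product split_def)
  finally have poly_q: "poly (q u) a = (\<Sum>x\<in>{..<n} \<times> B. to_ac (u x) * g x)" for u .
  have "\<forall>x\<in>{..<n} \<times> B. u x = 0" if "(\<Sum>x\<in>{..<n} \<times> B. to_ac (u x) * g x) = 0" for u
  proof -
    have "q u = 0" using min[OF qL _ qdeg] that poly_q by simp
    then have "(\<Sum>b\<in>B. to_ac (u (i, b)) * b) = 0" if "i < n" for i
      using coeff_q[of u i] that by simp
    then have "u (i, b) = 0" if "i < n" "b \<in> B" for i b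
      using Bind[of "\<lambda>b. u (i, b)"] that by blast
    then show ?thesis by auto
  qed
  moreover have "adjoin L a = range (\<lambda>u. \<Sum>x\<in>{..<n} \<times> B. to_ac (u x) * g x)"
  proof (intro equalityI subsetI)
    fix z assume "z \<in> adjoin L a"
    then obtain f where f: "poly_over L f" "z = poly f a" by (auto simp: adjoin_def)
    \<comment> \<open>Reduction modulo \<open>p\<close> changes no value at \<open>a\<close> and
      brings the degree below \<open>n\<close>.\<close>
    obtain s r where sr: "poly_over L s" "poly_over L r" "f = s * p + r" "Polynomial.degree r < n"
      using poly_over_division[OF L pL(1,2) f(1)] npos unfolding n_def by blast
    have "\<forall>i. \<exists>u. Polynomial.coeff r i = (\<Sum>b\<in>B. to_ac (u b) * b)"
      using sr(2) unfolding poly_over_def Bspan by blast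
    then obtain u where u: "\<And>i. Polynomial.coeff r i = (\<Sum>b\<in>B. to_ac (u i b) * b)" by metis
    have "r = q (\<lambda>(i, b). u i b)"
    proof (rule poly_eqI)
      fix i
      show "Polynomial.coeff r i = Polynomial.coeff (q (\<lambda>(i, b). u i b)) i"
        using u[of i] sr(4) by (cases "i < n") (simp_all add: coeff_q coeff_eq_0)
    qed
    then have "z = (\<Sum>x\<in>{..<n} \<times> B. to_ac ((\<lambda>(i, b). u i b) x) * g x)"
      using f(2) sr(3) pL(3) poly_q by simp
    then show "z \<in> range (\<lambda>u. \<Sum>x\<in>{..<n} \<times> B. to_ac (u x) * g x)" by blast
  next
    fix z assume "z \<in> range (\<lambda>u. \<Sum>x\<in>{..<n} \<times> B. to_ac (u x) * g x)"
    then obtain u where "z = poly (q u) a" by (auto simp: poly_q)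
    then show "z \<in> adjoin L a" using qL unfolding adjoin_def by blast
  qed
  ultimately have "K_basis (g ` ({..<n} \<times> B)) (adjoin L a) \<and> card (g ` ({..<n} \<times> B)) = card ({..<n} \<times> B)"
    using fin by (intro K_basis_image) auto
  then show ?thesis by (auto simp: n_def card_cartesian_product)
qed

section \<open>Finitely generated extensions\<close>

definition alg_gen :: "'k::field alg_closure set \<Rightarrow> 'k alg_closure set" where
  "alg_gen S = generate_field type_ring (range to_ac \<union> S)"

lemma type_ring_ops:
  "\<one>\<^bsub>type_ring\<^esub> = (1::'a::field)" "\<zero>\<^bsub>type_ring\<^esub> = (0::'a)"
  "x \<oplus>\<^bsub>type_ring\<^esub> y = x + (y::'a)" "x \<otimes>\<^bsub>type_ring\<^esub> y = x * (y::'a)" "carrier type_ring = (UNIV :: 'a set)"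
  by (simp_all add: ring_of_type_algebra_def)

lemma type_ring_a_inv: "\<ominus>\<^bsub>type_ring\<^esub> x = - (x::'a::field)"
proof -
  interpret R: field "type_ring :: 'a ring" by (rule field_from_type_algebra)
  show ?thesis
    by (rule R.minus_equality) (simp_all add: type_ring_ops)
qed

lemma type_ring_m_inv: "x \<noteq> 0 \<Longrightarrow> inv\<^bsub>type_ring\<^esub> x = inverse (x::'a::field)"
proof -
  interpret R: field "type_ring :: 'a ring" by (rule field_from_type_algebra)
  show "x \<noteq> 0 \<Longrightarrow> ?thesis"
    by (rule R.comm_inv_char) (simp_all add: type_ring_ops)
qed

lemma K_subalgebra_alg_gen: "K_subalgebra (alg_gen S)"
  using generate_field.eng_add[of _ type_ring "range to_ac \<union> S"]
    generate_field.eng_mult[of _ type_ring "range to_ac \<union> S"]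
    generate_field.incl[of _ "range to_ac \<union> S" type_ring]
  unfolding K_subalgebra_def alg_gen_def type_ring_ops by blast

lemma alg_gen_superset: "S \<subseteq> alg_gen S"
  unfolding alg_gen_def using generate_field.incl[of _ "range to_ac \<union> S" type_ring] by blast

lemma alg_gen_least:
  assumes "K_subalgebra L" "S \<subseteq> L"
  shows "alg_gen S \<subseteq> L"
proof
  fix x assume "x \<in> alg_gen S"
  then show "x \<in> L" unfolding alg_gen_def
    by (induction rule: generate_field.induct)
      (use assms in \<open>auto simp: type_ring_ops type_ring_a_inv type_ring_m_inv
        intro: K_subalgebra_closed[OF assms(1)] K_subalgebra_inverse[OF assms(1)]\<close>)
qed

lemma alg_gen_insert: "alg_gen (insert a S) = adjoin (alg_gen S) a"
proof (rule equalityI)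
  note sub = K_subalgebra_alg_gen[of S]
  show "alg_gen (insert a S) \<subseteq> adjoin (alg_gen S) a"
    using alg_gen_superset[of S] adjoin_extends[OF sub, of a]
    by (intro alg_gen_least K_subalgebra_adjoin sub) auto
  show "adjoin (alg_gen S) a \<subseteq> alg_gen (insert a S)"
    using alg_gen_superset[of "insert a S"]
    by (intro adjoin_least alg_gen_least K_subalgebra_alg_gen) auto
qed

lemma alg_gen_empty: "alg_gen {} = range to_ac"
proof (rule equalityI)
  have "K_subalgebra (range to_ac)" unfolding K_subalgebra_def
    by (auto simp flip: to_ac_add to_ac_mult)
  then show "alg_gen {} \<subseteq> range to_ac" by (intro alg_gen_least) auto
  show "range to_ac \<subseteq> alg_gen {}" using K_subalgebra_alg_gen unfolding K_subalgebra_def by blast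
qed

text \<open>Both claims come from one induction so that they share the same \<open>n\<close>, the
  product of the degrees of the successive generators. The second is conditional because
  \<open>R\<close> is arbitrary and the base may have no finite basis.\<close>

lemma alg_gen_extension:
  fixes R :: "'k::field_char_0 alg_closure set"
  assumes "finite S"
  shows "\<exists>n. uniform_extension (alg_gen R) (alg_gen (S \<union> R)) n \<and>
    (\<forall>B. K_basis B (alg_gen R) \<longrightarrow> (\<exists>B'. K_basis B' (alg_gen (S \<union> R)) \<and> card B' = n * card B))"
  using assms
proof (induction S rule: finite_induct)
  case empty
  have "K_extensions (alg_gen R) (alg_gen R) \<sigma> = {\<sigma>}" if "\<sigma> \<in> K_embeddings (alg_gen R)" for \<sigma>
    using that K_embeddings_iff[OF K_subalgebra_alg_gen, of _ R]
    by (auto simp: K_extensions_def extensional_restrict)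
  then have "uniform_extension (alg_gen R) (alg_gen R) 1" by (simp add: uniform_extension_def)
  then show ?case by (intro exI[of _ 1]) auto
next
  case (insert a S)
  let ?L = "alg_gen (S \<union> R)"
  note L = K_subalgebra_alg_gen
  obtain n where n: "uniform_extension (alg_gen R) ?L n"
    "\<forall>B. K_basis B (alg_gen R) \<longrightarrow> (\<exists>B'. K_basis B' ?L \<and> card B' = n * card B)"
    using insert.IH by blast
  obtain p where p: "min_kernel_poly ?L (\<lambda>x. x) a p"
    using min_kernel_poly_exists[OF L K_hom_id] by blast
  have eq: "alg_gen (insert a S \<union> R) = adjoin ?L a" by (simp add: alg_gen_insert)
  have "uniform_extension ?L (adjoin ?L a) (Polynomial.degree p)"
    using card_K_extensions_adjoin[OF L p] min_kernel_poly_degree_pos[OF L K_hom_id p] adjoin_extends(1)[OF L]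
    by (auto simp: uniform_extension_def)
  then have "uniform_extension (alg_gen R) (adjoin ?L a) (Polynomial.degree p * n)"
    by (rule uniform_extension_trans[OF L L K_subalgebra_adjoin[OF L] n(1)])
  moreover have "\<exists>B'. K_basis B' (adjoin ?L a) \<and> card B' = Polynomial.degree p * n * card B"
    if "K_basis B (alg_gen R)" for B
    using n(2) that K_basis_adjoin[OF L p] by (metis mult.assoc)
  ultimately show ?case unfolding eq by blast
qed

text \<open>Over the base K there is only the one embedding \<open>\<iota>\<close>, and
  \<open>{1}\<close> is a basis, so the common factor of extensions and dimensions is both numbers
  at once.\<close>

lemma card_K_embeddings_alg_gen:
  fixes S :: "'k::field_char_0 alg_closure set"
  assumes "finite S"
  shows "card (K_embeddings (alg_gen S)) = ext_degree (alg_gen S)" "ext_degree (alg_gen S) > 0"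
proof -
  let ?K = "range to_ac :: 'k alg_closure set"
  have K: "K_subalgebra ?K" using K_subalgebra_alg_gen[of "{}"] by (simp add: alg_gen_empty)
  define \<iota> where "\<iota> = restrict (\<lambda>x. x) ?K"
  have B: "K_basis {1} ?K"
    unfolding K_basis_def by (auto simp: image_def)
  obtain n where n: "uniform_extension ?K (alg_gen S) n"
      "\<forall>B. K_basis B ?K \<longrightarrow> (\<exists>B'. K_basis B' (alg_gen S) \<and> card B' = n * card B)"
    using alg_gen_extension[OF assms, of "{}"] by (auto simp: alg_gen_empty)
  obtain B' where "K_basis B' (alg_gen S)" "card B' = n" using n(2) B by force
  then have deg: "ext_degree (alg_gen S) = n" using ext_degree_K_basis by blast
  have \<iota>: "\<iota> \<in> K_embeddings ?K"
    unfolding K_embeddings_iff[OF K] \<iota>_def by (auto intro: K_hom_cong[OF K_hom_id K])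
  have "K_extensions ?K (alg_gen S) \<iota> = K_embeddings (alg_gen S)"
    unfolding K_extensions_def \<iota>_def
    using K_embeddings_iff[OF K_subalgebra_alg_gen, of _ S] by (auto simp: K_hom_def fun_eq_iff)
  then show "card (K_embeddings (alg_gen S)) = ext_degree (alg_gen S)" "ext_degree (alg_gen S) > 0"
    using n(1) \<iota> deg by (auto simp: uniform_extension_def)
qed

text \<open>Every embedding of the smaller field has the same number of extensions, so numerator and
  denominator grow by the same factor. This makes the height independent of the field over which it
  is computed.\<close>

lemma K_embeddings_average:
  fixes G :: "('k::field_char_0 alg_closure \<Rightarrow> 'k alg_closure) \<Rightarrow> real"
  assumes "finite S" "finite T" "T \<subseteq> alg_gen S"
  shows "(\<Sum>\<sigma>\<in>K_embeddings (alg_gen T). G \<sigma>) / real (ext_degree (alg_gen T)) =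
    (\<Sum>\<sigma>\<in>K_embeddings (alg_gen S). G (restrict \<sigma> (alg_gen T))) / real (ext_degree (alg_gen S))"
proof -
  let ?L = "alg_gen T" and ?L' = "alg_gen S"
  note L = K_subalgebra_alg_gen
  have eq: "alg_gen (S \<union> T) = ?L'"
    using assms(3) alg_gen_superset[of S] alg_gen_superset[of "S \<union> T"]
    by (intro equalityI alg_gen_least L) auto
  obtain n where n: "uniform_extension ?L ?L' n"
    using alg_gen_extension[OF assms(1), of T] eq by metis
  have sub: "?L \<subseteq> ?L'" and n0: "n > 0" and cn: "\<And>\<sigma>. \<sigma> \<in> K_embeddings ?L \<Longrightarrow> card (K_extensions ?L ?L' \<sigma>) = n"
    using n by (auto simp: uniform_extension_def)
  have fin: "finite (K_embeddings ?L)" "finite (K_embeddings ?L')"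
    using card_K_embeddings_alg_gen[OF assms(1)] card_K_embeddings_alg_gen[OF assms(2)]
    by (metis card.infinite less_irrefl)+
  have grp: "(\<Sum>\<sigma>\<in>K_embeddings ?L'. F (restrict \<sigma> ?L)) = real n * (\<Sum>\<sigma>\<in>K_embeddings ?L. F \<sigma>)"
    for F :: "_ \<Rightarrow> real"
  proof -
    have "(\<Sum>\<sigma>\<in>K_embeddings ?L'. F (restrict \<sigma> ?L)) =
        (\<Sum>\<sigma>\<in>K_embeddings ?L. \<Sum>\<tau>\<in>{\<tau>\<in>K_embeddings ?L'. restrict \<tau> ?L = \<sigma>}. F (restrict \<tau> ?L))"
      using restrict_K_embedding[OF L L sub] by (intro sum.group[symmetric] fin) auto
    also have "\<dots> = (\<Sum>\<sigma>\<in>K_embeddings ?L. \<Sum>\<tau>\<in>K_extensions ?L ?L' \<sigma>. F \<sigma>)"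
      by (intro sum.cong) (auto simp: K_extensions_def)
    also have "\<dots> = (\<Sum>\<sigma>\<in>K_embeddings ?L. real n * F \<sigma>)"
      by (intro sum.cong) (auto simp: cn)
    finally show ?thesis by (simp add: sum_distrib_left)
  qed
  \<comment> \<open>The constant function 1 shows that the number of embeddings, hence the degree,
    is multiplied by \<open>n\<close>.\<close>
  have "real (card (K_embeddings ?L')) = real n * real (card (K_embeddings ?L))"
    using grp[of "\<lambda>_. 1"] by simp
  then show ?thesis
    using grp[of G] n0 card_K_embeddings_alg_gen(1)[OF assms(1)] card_K_embeddings_alg_gen(1)[OF assms(2)]
    by simp
qed

section \<open>Absolute values and heights over a common field\<close>

locale abs_val =
  fixes w :: "'a::field \<Rightarrow> real"
  assumes absolute_value: "absolute_value w"
begin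

lemma nonneg [simp]: "0 \<le> w x"
  and eq_0_iff [simp]: "w x = 0 \<longleftrightarrow> x = 0"
  and mult: "w (x * y) = w x * w y"
  and triangle: "w (x + y) \<le> w x + w y"
  using absolute_value by (auto simp: absolute_value_def)

lemma zero [simp]: "w 0 = 0"
  by simp

lemma one [simp]: "w 1 = 1"
  using mult[of 1 1] by simp

lemma uminus [simp]: "w (- x) = w x"
proof -
  have "w (- 1) * w (- 1) = 1" using mult[of "- 1" "- 1"] by simp
  then have "w (- 1) = 1"
    using nonneg[of "- 1"] by (metis abs_of_nonneg abs_1 power2_eq_1_iff power2_eq_square abs_minus_cancel)
  then show ?thesis using mult[of "- 1" x] by simp
qed

lemma power: "w (x ^ n) = w x ^ n"
  by (induction n) (auto simp: mult)

lemma diff_triangle: "w (x - y) \<le> w x + w y"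
  using triangle[of x "- y"] by simp

lemma sum_triangle: "w (sum f I) \<le> (\<Sum>i\<in>I. w (f i))"
  by (induction I rule: infinite_finite_induct) (auto intro: order.trans[OF triangle])

end

text \<open>Squaring Bernoulli's inequality for exponent n bounds r^(2n) below by a quadratic in n,
  which exceeds 2n + 1 once n is beyond 2 / \<delta>^2.\<close>

lemma exponential_beats_linear:
  fixes r :: real
  assumes "\<And>n::nat. r ^ n \<le> real n + 1"
  shows "r \<le> 1"
proof (rule ccontr)
  assume "\<not> r \<le> 1"
  define \<delta> where "\<delta> = r - 1"
  have \<delta>: "\<delta> > 0" "r = 1 + \<delta>" using \<open>\<not> r \<le> 1\<close> by (auto simp: \<delta>_def)
  obtain n :: nat where n: "real n > 2 / \<delta>\<^sup>2" using reals_Archimedean2 by blast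
  then have "n > 0" using \<delta> by (metis divide_nonneg_nonneg gr0I linorder_not_less of_nat_0 zero_le_numeral zero_le_power2)
  have "1 + real n * \<delta> \<le> r ^ n" using Bernoulli_inequality[of \<delta> n] \<delta> by simp
  then have "(1 + real n * \<delta>)\<^sup>2 \<le> (r ^ n)\<^sup>2" using \<delta> by (intro power_mono) auto
  also have "\<dots> = r ^ (2 * n)" by (simp add: power_mult[symmetric] mult.commute)
  also have "\<dots> \<le> 2 * real n + 1" using assms[of "2 * n"] by simp
  finally have "(real n)\<^sup>2 * \<delta>\<^sup>2 \<le> 2 * real n"
    using \<delta> by (simp add: power2_eq_square algebra_simps) (smt (verit) mult_nonneg_nonneg of_nat_0_le_iff)
  then have "real n * \<delta>\<^sup>2 \<le> 2" using \<open>n > 0\<close> by (simp add: power2_eq_square mult_ac)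
  then show False using n \<delta> by (simp add: field_simps)
qed

text \<open>Boundedness on the integers is what can be read off from a place; the ultrametric
  inequality is derived from it.\<close>

locale ultra_abs_val = abs_val +
  assumes of_nat_le_1: "w (of_nat n) \<le> 1"
begin

text \<open>The n-th power of \<open>x + y\<close> has n + 1 binomial terms, each of absolute value
  at most M^n because binomial coefficients are integers. The powers of \<open>w (x + y) / M\<close>
  thus grow at most linearly.\<close>

lemma ultra: "w (x + y) \<le> max (w x) (w y)"
proof (cases "max (w x) (w y) = 0")
  case True
  then have "x = 0" "y = 0"
    by (metis eq_0_iff max.cobounded1 nonneg order_antisym, metis eq_0_iff max.cobounded2 nonneg order_antisym)
  then show ?thesis by simp
next
  case False
  define M where "M = max (w x) (w y)"
  have M: "M > 0" "w x \<le> M" "w y \<le> M" using False nonneg[of x] unfolding M_def by linarith+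
  have "(w (x + y) / M) ^ n \<le> real n + 1" for n
  proof -
    have "w (x + y) ^ n = w (\<Sum>k\<le>n. of_nat (n choose k) * x ^ k * y ^ (n - k))"
      by (simp add: power[symmetric] binomial_ring)
    also have "\<dots> \<le> (\<Sum>k\<le>n. w (of_nat (n choose k) * x ^ k * y ^ (n - k)))" by (rule sum_triangle)
    also have "\<dots> \<le> (\<Sum>k\<le>n. 1 * M ^ k * M ^ (n - k))"
      unfolding mult power
      by (intro sum_mono mult_mono power_mono of_nat_le_1 M) (use M in auto)
    also have "\<dots> = (real n + 1) * M ^ n" by (simp add: power_add[symmetric])
    finally show ?thesis using M by (simp add: power_divide field_simps)
  qed
  then have "w (x + y) / M \<le> 1" by (rule exponential_beats_linear)
  then show ?thesis using M by (simp add: M_def[symmetric])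
qed

lemma ultra_sum: "(\<And>i. i \<in> I \<Longrightarrow> w (f i) \<le> M) \<Longrightarrow> 0 \<le> M \<Longrightarrow> w (sum f I) \<le> M"
  by (induction I rule: infinite_finite_induct) (auto intro: order.trans[OF ultra])

lemma ultra_diff: "w (x - y) \<le> max (w x) (w y)"
  using ultra[of x "- y"] by simp

lemma ultra_dominant:
  assumes "w y < w x"
  shows "w (x + y) = w x"
  using ultra[of x y] ultra_diff[of "x + y" y] assms by simp

end

context abs_val
begin

text \<open>Cauchy's bound: if \<open>w x > 1\<close>, solve for the leading power and cancel
  \<open>w x ^ (n - 1)\<close>.\<close>

lemma root_bound:
  assumes "Polynomial.lead_coeff p = 1" "poly p x = 0"
  shows "w x \<le> 1 + (\<Sum>i<Polynomial.degree p. w (Polynomial.coeff p i))"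
proof (cases "w x \<le> 1")
  case True
  then show ?thesis by (simp add: add_increasing2 sum_nonneg)
next
  case False
  define n where "n = Polynomial.degree p"
  define S where "S = (\<Sum>i<n. w (Polynomial.coeff p i))"
  have "n > 0" using assms unfolding n_def
    by (metis degree_0_id gr0I mult.right_neutral one_neq_zero one_pCons poly_1)
  have "x ^ n = - (\<Sum>i<n. Polynomial.coeff p i * x ^ i)"
    using assms unfolding poly_altdef n_def
    by (metis (no_types, lifting) add_eq_0_iff add.commute lessThan_Suc_atMost mult_1 sum.lessThan_Suc)
  then have "w x ^ n \<le> (\<Sum>i<n. w (Polynomial.coeff p i) * w x ^ i)"
    using sum_triangle[of "\<lambda>i. Polynomial.coeff p i * x ^ i" "{..<n}"]
    by (metis (no_types, lifting) mult power sum.cong uminus)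
  also have "\<dots> \<le> (\<Sum>i<n. w (Polynomial.coeff p i) * w x ^ (n - 1))"
    using False \<open>n > 0\<close> by (intro sum_mono mult_left_mono power_increasing) auto
  also have "\<dots> = S * w x ^ (n - 1)" by (simp add: S_def sum_distrib_right)
  finally have "w x * w x ^ (n - 1) \<le> S * w x ^ (n - 1)"
    using \<open>n > 0\<close> by (metis power_eq_if not_gr_zero)
  then have "w x \<le> S" using False by (simp add: mult_le_cancel_right)
  then show ?thesis by (simp add: S_def n_def)
qed

end

text \<open>Otherwise the lower terms would amount to at most \<open>w x ^ (n - 1)\<close>, too
  little to cancel the leading power.\<close>

lemma (in ultra_abs_val) root_bound_integral:
  assumes "Polynomial.lead_coeff p = 1" "poly p x = 0" "\<And>i. w (Polynomial.coeff p i) \<le> 1"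
  shows "w x \<le> 1"
proof (rule ccontr)
  assume x: "\<not> w x \<le> 1"
  define n where "n = Polynomial.degree p"
  have "n > 0" using assms unfolding n_def
    by (metis degree_0_id gr0I mult.right_neutral one_neq_zero one_pCons poly_1)
  have "x ^ n = - (\<Sum>i<n. Polynomial.coeff p i * x ^ i)"
    using assms unfolding poly_altdef n_def
    by (metis (no_types, lifting) add_eq_0_iff add.commute lessThan_Suc_atMost mult_1 sum.lessThan_Suc)
  then have "w x ^ n = w (\<Sum>i<n. Polynomial.coeff p i * x ^ i)" by (metis power uminus)
  also have "\<dots> \<le> w x ^ (n - 1)"
  proof (rule ultra_sum)
    fix i assume "i \<in> {..<n}"
    then have "w (Polynomial.coeff p i) * w x ^ i \<le> 1 * w x ^ (n - 1)"
      using x assms(3) by (intro mult_mono power_increasing) auto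
    then show "w (Polynomial.coeff p i * x ^ i) \<le> w x ^ (n - 1)" by (simp add: mult power)
  qed simp
  finally show False using x \<open>n > 0\<close> by (simp add: power_le_imp_le_exp not_le)
qed

text \<open>An archimedean place gives 2 the value 2. At a prime, integers have no denominator; at a
  divisor, they lie in the chart ring and so in the valuation ring.\<close>

lemma standard_place_cases:
  fixes \<Omega> :: "('k::field_char_0 \<Rightarrow> real) set"
  assumes "standard_places \<Omega>" "v \<in> \<Omega>"
  shows "v 2 = 2 \<or> (\<forall>n. v (of_nat n) \<le> 1)"
proof -
  have padic: "v (of_nat n) \<le> 1" if "\<forall>q. v (of_rat q) = padic_abs p q" "Factorial_Ring.prime p" for p n
  proof -
    have "v (of_nat n) = padic_abs p (of_nat n)" using that(1) by (metis of_rat_of_nat_eq)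
    also have "\<dots> \<le> 1"
      using prime_gt_1_nat[OF that(2)]
      by (auto simp: padic_abs_def power_int_minus power_int_of_nat divide_simps)
    finally show ?thesis .
  qed
  have divisor: "v (of_nat k) \<le> 1"
    if P: "primeideal P (sub_ring (chart_ring F n \<xi> i))" and v: "{x. v x \<le> 1} = local_ring (chart_ring F n \<xi> i) P"
    for F n \<xi> i P k
  proof -
    let ?A = "chart_ring F n \<xi> i"
    have 1: "1 \<in> ?A" using generate_ring.one[of type_ring] by (simp add: chart_ring_def type_ring_ops)
    have add: "x + y \<in> ?A" if "x \<in> ?A" "y \<in> ?A" for x y
      using that generate_ring.eng_add[of _ type_ring] by (simp add: chart_ring_def type_ring_ops)
    have "- 1 \<in> ?A" using generate_ring.a_inv[OF generate_ring.one, of type_ring]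
      by (simp add: chart_ring_def type_ring_ops type_ring_a_inv)
    then have "0 \<in> ?A" using add[OF 1] by force
    then have nat: "of_nat k \<in> ?A" by (induction k) (auto intro: add 1)
    interpret primeideal P "sub_ring ?A" by (rule P)
    \<comment> \<open>A prime ideal is proper, so 1 is an admissible denominator and the local ring
      contains the chart ring.\<close>
    have "1 \<notin> P"
      using one_imp_carrier I_notcarr by (auto simp: ring_of_type_algebra_def)
    then have "of_nat k / 1 \<in> local_ring ?A P" unfolding local_ring_def using nat 1 by blast
    then show ?thesis using v by auto
  qed
  show ?thesis
  proof (cases "is_number_field TYPE('k) \<and> \<Omega> = number_field_places")
    case True
    then consider "\<forall>q. v (of_rat q) = \<bar>real_of_rat q\<bar>"
      | p where "Factorial_Ring.prime p" "\<forall>q. v (of_rat q) = padic_abs p q"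
      using assms(2) unfolding number_field_places_def by blast
    then show ?thesis
    proof cases
      case 1
      then have "v (of_rat 2) = \<bar>real_of_rat 2\<bar>" by blast
      then show ?thesis by simp
    next
      case 2
      then show ?thesis using padic by blast
    qed
  next
    case False
    then show ?thesis
      using assms divisor unfolding standard_places_def divisor_places_def by blast
  qed
qed

section \<open>Families of places, bounds for conjugates and heights over a common field\<close>

locale place_family =
  fixes \<Omega> :: "('k::field_char_0 \<Rightarrow> real) set"
    and N :: "('k \<Rightarrow> real) \<Rightarrow> nat"
    and E :: "('k \<Rightarrow> real) \<Rightarrow> 'k alg_closure \<Rightarrow> real"
  assumes standard: "standard_places \<Omega>"
    and product_formula: "product_formula \<Omega> N"
    and extends: "v \<in> \<Omega> \<Longrightarrow> extends_to_closure v (E v)"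
begin

lemma abs_val_E: "v \<in> \<Omega> \<Longrightarrow> abs_val (E v)"
  using extends by (simp add: abs_val_def extends_to_closure_def)

lemma E_to_ac: "v \<in> \<Omega> \<Longrightarrow> E v (to_ac x) = v x"
  using extends by (simp add: extends_to_closure_def)

lemma finite_places: "x \<noteq> 0 \<Longrightarrow> finite {v \<in> \<Omega>. v x \<noteq> 1}"
  using product_formula by (simp add: product_formula_def)

text \<open>By the product formula at 2 this condition fails only finitely often, and it rules out
  the archimedean places. Non-archimedean places above 2 fail it as well and are treated as
  exceptions.\<close>

definition ultra_places :: "('k \<Rightarrow> real) set" where
  "ultra_places = {v \<in> \<Omega>. v 2 = 1}"

lemma finite_not_ultra: "finite (\<Omega> - ultra_places)"
  by (rule finite_subset[OF _ finite_places[of 2]]) (auto simp: ultra_places_def)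

lemma ultra_abs_val_E:
  assumes "v \<in> ultra_places"
  shows "ultra_abs_val (E v)"
proof -
  have v: "v \<in> \<Omega>" "v 2 = 1" using assms by (auto simp: ultra_places_def)
  then have "v (of_nat n) \<le> 1" for n using standard_place_cases[OF standard v(1)] by auto
  then show ?thesis
    using abs_val_E[OF v(1)] E_to_ac[OF v(1), of "of_nat _"]
    by (simp add: ultra_abs_val_def ultra_abs_val_axioms_def)
qed

text \<open>One bound has to serve all fields and embeddings at once, because the field will grow
  with the parameters. That it is almost always 1 will make the total error a finite sum.\<close>

definition conjugates_bound :: "'k alg_closure \<Rightarrow> (('k \<Rightarrow> real) \<Rightarrow> real) \<Rightarrow> bool" where
  "conjugates_bound z B \<longleftrightarrow> finite {v \<in> \<Omega>. B v \<noteq> 1} \<and> (\<forall>v\<in>\<Omega>. 1 \<le> B v) \<and>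
     (\<forall>v\<in>\<Omega>. \<forall>L \<sigma>. K_subalgebra L \<longrightarrow> K_hom L \<sigma> \<longrightarrow> z \<in> L \<longrightarrow> E v (\<sigma> z) \<le> B v)"

text \<open>All conjugates are roots of one monic polynomial over K. At ultrametric places where its
  coefficients are integral the bound is 1, elsewhere it is Cauchy's bound.\<close>

lemma conjugates_bound_exists: "\<exists>B. conjugates_bound z B"
proof -
  obtain p0 :: "'k poly" where p0: "p0 \<noteq> 0" "poly (map_poly to_ac p0) z = 0"
    using alg_closure_algebraic by blast
  define p where "p = Polynomial.smult (inverse (Polynomial.lead_coeff p0)) p0"
  define q where "q = map_poly to_ac p"
  have "map_poly to_ac p = Polynomial.smult (to_ac (inverse (Polynomial.lead_coeff p0))) (map_poly to_ac p0)"
    unfolding p_def by (rule poly_eqI) (simp add: coeff_map_poly)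
  then have root: "poly q z = 0" using p0 by (simp add: q_def)
  have "Polynomial.lead_coeff p = 1" using p0 by (simp add: p_def)
  then have lc: "Polynomial.lead_coeff q = 1" by (simp add: q_def coeff_map_poly Polynomial.degree_map_poly)
  have cq: "Polynomial.coeff q i = to_ac (Polynomial.coeff p i)" for i by (simp add: q_def coeff_map_poly)
  define good where "good = {v \<in> ultra_places. \<forall>i. v (Polynomial.coeff p i) \<le> 1}"
  define B where "B v = (if v \<in> good then 1 else 1 + (\<Sum>i<Polynomial.degree q. E v (Polynomial.coeff q i)))" for v
  \<comment> \<open>A bad place has |2| different from 1 or gives one of the finitely many nonzero
    coefficients a value above 1; the product formula leaves finitely many places of each
    kind.\<close>
  have "\<Omega> - good \<subseteq> (\<Omega> - ultra_places) \<union>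
      (\<Union>i\<in>{i \<in> {..Polynomial.degree p}. Polynomial.coeff p i \<noteq> 0}. {v \<in> \<Omega>. v (Polynomial.coeff p i) \<noteq> 1})"
  proof
    fix v assume "v \<in> \<Omega> - good"
    then have v: "v \<in> \<Omega>" "v \<notin> good" by auto
    show "v \<in> (\<Omega> - ultra_places) \<union>
      (\<Union>i\<in>{i \<in> {..Polynomial.degree p}. Polynomial.coeff p i \<noteq> 0}. {v \<in> \<Omega>. v (Polynomial.coeff p i) \<noteq> 1})"
    proof (cases "v \<in> ultra_places")
      case True
      then obtain i where i: "v (Polynomial.coeff p i) > 1" using v by (auto simp: good_def not_le)
      have "v 0 = 0" using E_to_ac[OF v(1), of 0] abs_val.eq_0_iff[OF abs_val_E[OF v(1)], of 0] by simp
      then have "Polynomial.coeff p i \<noteq> 0" using i by auto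
      then show ?thesis using i v le_degree[of p i] by auto
    qed (use v in simp)
  qed
  then have fin: "finite (\<Omega> - good)"
    by (rule finite_subset) (intro finite_UnI finite_UN_I finite_not_ultra finite_places; simp)
  have "{v \<in> \<Omega>. B v \<noteq> 1} \<subseteq> \<Omega> - good" by (auto simp: B_def)
  then have 1: "finite {v \<in> \<Omega>. B v \<noteq> 1}" using fin finite_subset by blast
  have 2: "1 \<le> B v" if "v \<in> \<Omega>" for v
    unfolding B_def using abs_val.nonneg[OF abs_val_E[OF that]] by (simp add: sum_nonneg)
  have 3: "E v (\<sigma> z) \<le> B v" if v: "v \<in> \<Omega>" and L: "K_subalgebra L" and \<sigma>: "K_hom L \<sigma>" and z: "z \<in> L" for v L \<sigma>
  proof -
    have "map_poly \<sigma> q = q"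
      by (rule poly_eqI) (simp add: coeff_map_poly_K_hom[OF L \<sigma>] cq K_hom_to_ac[OF L \<sigma>])
    moreover have "poly_over L q" unfolding q_def by (rule poly_over_map_to_ac[OF L])
    ultimately have r: "poly q (\<sigma> z) = 0" using K_hom_poly[OF L \<sigma>, of q z] root z K_hom_0[OF L \<sigma>] by simp
    show ?thesis
    proof (cases "v \<in> good")
      case True
      then have "E v (Polynomial.coeff q i) \<le> 1" for i using v by (simp add: cq E_to_ac good_def)
      moreover have "ultra_abs_val (E v)" using True ultra_abs_val_E by (simp add: good_def)
      ultimately show ?thesis
        using ultra_abs_val.root_bound_integral[OF _ lc r] True by (simp add: B_def)
    next
      case False
      then show ?thesis using abs_val.root_bound[OF abs_val_E[OF v] lc r] by (simp add: B_def)
    qed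
  qed
  show ?thesis using 1 2 3 unfolding conjugates_bound_def by blast
qed

text \<open>All bounds are at least 1, so their product dominates each of them, and it is 1 outside
  a finite union of finite sets.\<close>

lemma uniform_conjugates_bound:
  assumes "finite Z"
  shows "\<exists>B. \<forall>z\<in>Z. conjugates_bound z B"
proof -
  obtain b where b: "\<And>z. conjugates_bound z (b z)" using conjugates_bound_exists by metis
  define B where "B v = (\<Prod>z\<in>Z. b z v)" for v
  have ge: "1 \<le> b z v" if "v \<in> \<Omega>" for z v using b that by (simp add: conjugates_bound_def)
  have le: "b z v \<le> B v" if "v \<in> \<Omega>" "z \<in> Z" for z v
  proof -
    have "B v = b z v * (\<Prod>z\<in>Z - {z}. b z v)" unfolding B_def using assms that by (simp add: prod.remove)
    moreover have "1 \<le> (\<Prod>z\<in>Z - {z}. b z v)" using ge[OF that(1)] by (intro prod_ge_1) auto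
    ultimately show ?thesis using ge[OF that(1), of z] by (simp add: mult_le_cancel_left1)
  qed
  have "{v \<in> \<Omega>. B v \<noteq> 1} \<subseteq> (\<Union>z\<in>Z. {v \<in> \<Omega>. b z v \<noteq> 1})"
    unfolding B_def using prod.neutral by fastforce
  then have "finite {v \<in> \<Omega>. B v \<noteq> 1}"
    by (rule finite_subset) (use b assms in \<open>auto simp: conjugates_bound_def\<close>)
  moreover have "1 \<le> B v" if "v \<in> \<Omega>" for v unfolding B_def using ge[OF that] by (intro prod_ge_1) auto
  ultimately have "conjugates_bound z B" if "z \<in> Z" for z
    using b[of z] le[OF _ that] unfolding conjugates_bound_def by (meson order.trans)
  then show ?thesis by blast
qed

text \<open>Averaging moves the height to the common field, and the infinite sum collapses to
  \<open>T\<close> because every other local term is ln 1.\<close>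

lemma weil_height_alg_gen:
  assumes S: "finite S" and x: "\<And>i. i \<le> m \<Longrightarrow> x i \<in> alg_gen S"
    and T: "finite T" "T \<subseteq> \<Omega>"
    and triv: "\<And>v \<sigma>. v \<in> \<Omega> - T \<Longrightarrow> \<sigma> \<in> K_embeddings (alg_gen S) \<Longrightarrow> (MAX i\<in>{..m}. E v (\<sigma> (x i))) = 1"
  shows "weil_height \<Omega> N E m x =
    (\<Sum>v\<in>T. \<Sum>\<sigma>\<in>K_embeddings (alg_gen S). real (N v) * ln (MAX i\<in>{..m}. E v (\<sigma> (x i)))) / real (ext_degree (alg_gen S))"
proof -
  define L where "L = alg_gen (x ` {..m})"
  have L: "coord_field m x = L" by (simp add: coord_field_def L_def alg_gen_def)
  have sub: "x ` {..m} \<subseteq> alg_gen S" using x by auto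
  define G where "G v \<sigma> = ln (MAX i\<in>{..m}. E v (\<sigma> (x i)))" for v \<sigma>
  have "x i \<in> L" if "i \<le> m" for i using alg_gen_superset[of "x ` {..m}"] that by (auto simp: L_def)
  then have "G v (restrict \<sigma> L) = G v \<sigma>" for v \<sigma>
    by (simp add: G_def cong: image_cong_simp)
  then have avg: "(\<Sum>\<sigma>\<in>K_embeddings L. G v \<sigma>) / real (ext_degree L) =
      (\<Sum>\<sigma>\<in>K_embeddings (alg_gen S). G v \<sigma>) / real (ext_degree (alg_gen S))" for v
    using K_embeddings_average[OF S _ sub, of "G v"] by (simp add: L_def)
  have "ext_degree L > 0" unfolding L_def by (rule card_K_embeddings_alg_gen) simp
  have "(\<Sum>\<sigma>\<in>K_embeddings (alg_gen S). G v \<sigma>) = 0" if "v \<in> \<Omega> - T" for v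
    using triv[OF that] by (simp add: G_def)
  \<comment> \<open>The vanishing is known for the large field; equality of the averages carries it
    to the field of coordinates.\<close>
  then have zero: "(\<Sum>\<sigma>\<in>K_embeddings L. G v \<sigma>) = 0" if "v \<in> \<Omega> - T" for v
    using avg[of v] that \<open>ext_degree L > 0\<close> by simp
  have "(\<Sum>\<^sub>\<infinity>v\<in>\<Omega>. real (N v) * (\<Sum>\<sigma>\<in>K_embeddings L. G v \<sigma>)) =
      (\<Sum>\<^sub>\<infinity>v\<in>T. real (N v) * (\<Sum>\<sigma>\<in>K_embeddings L. G v \<sigma>))"
    using T zero by (intro infsum_cong_neutral) auto
  also have "\<dots> = (\<Sum>v\<in>T. real (N v) * (\<Sum>\<sigma>\<in>K_embeddings L. G v \<sigma>))" using T by simp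
  finally have "weil_height \<Omega> N E m x =
      (\<Sum>v\<in>T. real (N v) * (\<Sum>\<sigma>\<in>K_embeddings L. G v \<sigma>)) / real (ext_degree L)"
    by (simp add: weil_height_def Let_def L G_def)
  then have "weil_height \<Omega> N E m x =
      (\<Sum>v\<in>T. real (N v) * ((\<Sum>\<sigma>\<in>K_embeddings L. G v \<sigma>) / real (ext_degree L)))"
    by (subst (asm) sum_divide_distrib) simp
  then show ?thesis unfolding avg
    by (simp add: G_def sum_divide_distrib sum_distrib_left)
qed

end

section \<open>Orbits at one place\<close>

definition Phi_orbit :: "nat \<Rightarrow> nat \<Rightarrow> (nat \<Rightarrow> 'a::comm_ring_1) \<Rightarrow> (nat \<Rightarrow> 'a) \<Rightarrow> nat \<Rightarrow> nat \<Rightarrow> 'a" where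
  "Phi_orbit d m l c n = (Phi d m l ^^ n) (affine_point c)"

lemma Phi_orbit_coord_0 [simp]: "Phi_orbit d m l c n 0 = 1"
  by (induction n) (simp_all add: Phi_orbit_def Phi_def affine_point_def)

lemma Phi_orbit_start: "i \<noteq> 0 \<Longrightarrow> Phi_orbit d m l c 0 i = c i"
  by (simp add: Phi_orbit_def affine_point_def)

text \<open>The zeroth coordinate stays 1, so its powers disappear and every other coordinate
  evolves on its own.\<close>

lemma Phi_orbit_Suc:
  "i \<noteq> 0 \<Longrightarrow> Phi_orbit d m l c (Suc n) i = Phi_orbit d m l c n i ^ d + (\<Sum>j=1..m. l j * Phi_orbit d m l c n i ^ (m - j))"
  using Phi_orbit_coord_0[of d m l c n] by (simp add: Phi_orbit_def Phi_def homog_f_def)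

lemma Phi_orbit_in_subalgebra:
  assumes L: "K_subalgebra L" "\<And>j. j \<in> {1..m} \<Longrightarrow> l j \<in> L" "\<And>i. i \<in> {1..m} \<Longrightarrow> c i \<in> L" "i \<le> m"
  shows "Phi_orbit d m l c n i \<in> L"
  using assms(4)
proof (induction n arbitrary: i)
  case 0
  then show ?case using L by (cases "i = 0") (auto simp: Phi_orbit_start K_subalgebra_1)
next
  case (Suc n)
  then show ?case using L
    by (cases "i = 0") (auto simp: Phi_orbit_Suc intro!: K_subalgebra_closed)
qed

text \<open>Iterates are polynomial expressions in parameters and starting point, so conjugating an
  orbit gives the orbit of the conjugated data. Every embedding thus yields a local problem of the
  same kind.\<close>

lemma K_hom_orbit:
  assumes L: "K_subalgebra L" "\<And>j. j \<in> {1..m} \<Longrightarrow> l j \<in> L" "\<And>i. i \<in> {1..m} \<Longrightarrow> c i \<in> L"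
    and \<sigma>: "K_hom L \<sigma>" and i: "i \<le> m"
  shows "\<sigma> (Phi_orbit d m l c n i) = Phi_orbit d m (\<sigma> \<circ> l) (\<sigma> \<circ> c) n i"
  using i
proof (induction n arbitrary: i)
  case 0
  then show ?case by (cases "i = 0") (simp_all add: Phi_orbit_start K_hom_1[OF L(1) \<sigma>])
next
  case (Suc n)
  have o: "Phi_orbit d m l c n i \<in> L" using Phi_orbit_in_subalgebra[OF L Suc.prems] .
  have "\<sigma> (\<Sum>j=1..m. l j * Phi_orbit d m l c n i ^ (m - j)) = (\<Sum>j=1..m. \<sigma> (l j) * \<sigma> (Phi_orbit d m l c n i) ^ (m - j))"
  proof (subst K_hom_sum[OF L(1) \<sigma>])
    fix j assume "j \<in> {1..m}"
    then show "l j * Phi_orbit d m l c n i ^ (m - j) \<in> L" using o L by (auto intro!: K_subalgebra_closed[OF L(1)])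
  next
    show "(\<Sum>j=1..m. \<sigma> (l j * Phi_orbit d m l c n i ^ (m - j))) =
        (\<Sum>j=1..m. \<sigma> (l j) * \<sigma> (Phi_orbit d m l c n i) ^ (m - j))"
      by (intro sum.cong refl)
        (simp add: K_hom_mult[OF L(1) \<sigma> L(2)] K_hom_power[OF L(1) \<sigma> o] K_subalgebra_power[OF L(1) o])
  qed
  moreover have "(\<Sum>j=1..m. l j * Phi_orbit d m l c n i ^ (m - j)) \<in> L"
    using o L by (auto intro!: K_subalgebra_closed[OF L(1)])
  ultimately show ?case using Suc o
    by (cases "i = 0")
      (simp_all add: Phi_orbit_Suc K_hom_1[OF L(1) \<sigma>] K_hom_add[OF L(1) \<sigma>] K_hom_power[OF L(1) \<sigma>] K_subalgebra_power[OF L(1)])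
qed

section \<open>Sequences that are multiplied by almost d in each step\<close>

lemma quasi_geometric_upper:
  fixes L :: "nat \<Rightarrow> real"
  assumes d: "d > 1" and "e \<ge> 0" and step: "\<And>n. n \<ge> k \<Longrightarrow> L (Suc n) \<le> d * L n + e" and "n \<ge> k"
  shows "L (Suc n) / d ^ Suc n + e / ((d - 1) * d ^ Suc n) \<le> L n / d ^ n + e / ((d - 1) * d ^ n)"
proof -
  have "L (Suc n) / d ^ Suc n + e / ((d - 1) * d ^ Suc n) \<le> (d * L n + e) / d ^ Suc n + e / ((d - 1) * d ^ Suc n)"
    using step[OF \<open>n \<ge> k\<close>] d by (intro add_right_mono divide_right_mono) auto
  also have "\<dots> = L n / d ^ n + (e / d ^ Suc n + e / ((d - 1) * d ^ Suc n))"
    using d by (simp add: add_divide_distrib)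
  also have "e / d ^ Suc n + e / ((d - 1) * d ^ Suc n) = e / ((d - 1) * d ^ n)"
    using d by (simp add: divide_simps) (simp add: algebra_simps)
  finally show ?thesis .
qed

text \<open>The correction e / ((d - 1) d^n) is the sum of the errors e / d^(j + 1) over all j from
  n on. With it added, L n / d^n is nonnegative and decreases from index \<open>k\<close> on, and
  the correction itself tends to 0.\<close>

lemma quasi_geometric_limit:
  fixes L :: "nat \<Rightarrow> real"
  assumes d: "d > 1" and e: "e \<ge> 0" and L: "\<And>n. L n \<ge> 0"
    and step: "\<And>n. n \<ge> k \<Longrightarrow> L (Suc n) \<le> d * L n + e"
  shows "\<exists>g. (\<lambda>n. L n / d ^ n) \<longlonglongrightarrow> g \<and> 0 \<le> g \<and> g \<le> L k / d ^ k + e / ((d - 1) * d ^ k)"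
proof -
  define v where "v n = L (n + k) / d ^ (n + k) + e / ((d - 1) * d ^ (n + k))" for n
  have dec: "decseq v"
    using quasi_geometric_upper[where L = L and k = k, OF d e step] unfolding v_def
    by (intro decseq_SucI) (simp only: add_Suc le_add2)
  have "v n \<ge> 0" for n using L d e by (simp add: v_def)
  then obtain g where g: "v \<longlonglongrightarrow> g" "\<And>n. g \<le> v n"
    using decseq_convergent[OF dec, of 0] by blast
  have "(\<lambda>n. e / ((d - 1) * d ^ n)) \<longlonglongrightarrow> 0"
    using d by real_asymp
  then have "(\<lambda>n. e / ((d - 1) * d ^ (n + k))) \<longlonglongrightarrow> 0" by (rule LIMSEQ_ignore_initial_segment)
  then have "(\<lambda>n. v n - e / ((d - 1) * d ^ (n + k))) \<longlonglongrightarrow> g - 0" by (intro tendsto_diff g)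
  then have "(\<lambda>n. L (n + k) / d ^ (n + k)) \<longlonglongrightarrow> g" by (simp add: v_def)
  then have lim: "(\<lambda>n. L n / d ^ n) \<longlonglongrightarrow> g" by (rule LIMSEQ_offset)
  moreover have "0 \<le> g" using lim L d by (intro LIMSEQ_le_const[OF lim]) auto
  moreover have "g \<le> L k / d ^ k + e / ((d - 1) * d ^ k)" using g(2)[of 0] by (simp add: v_def)
  ultimately show ?thesis by blast
qed

lemma quasi_geometric_limit_two_sided:
  fixes L :: "nat \<Rightarrow> real"
  assumes d: "d > 1" and e: "e \<ge> 0" and L: "\<And>n. L n \<ge> 0"
    and step: "\<And>n. n \<ge> k \<Longrightarrow> \<bar>L (Suc n) - d * L n\<bar> \<le> e"
  shows "\<exists>g. (\<lambda>n. L n / d ^ n) \<longlonglongrightarrow> g \<and> \<bar>g - L k / d ^ k\<bar> \<le> e / ((d - 1) * d ^ k)"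
proof -
  have up: "L (Suc n) \<le> d * L n + e" and low: "- L (Suc n) \<le> d * - L n + e" if "n \<ge> k" for n
    using step[OF that] by (auto simp: abs_le_iff)
  obtain g where g: "(\<lambda>n. L n / d ^ n) \<longlonglongrightarrow> g" "g \<le> L k / d ^ k + e / ((d - 1) * d ^ k)"
    using quasi_geometric_limit[where L = L and k = k, OF d e L up] by blast
  have dec: "- L n / d ^ n + e / ((d - 1) * d ^ n) \<le> - L k / d ^ k + e / ((d - 1) * d ^ k)" if "n \<ge> k" for n
    using that
  proof (induction rule: dec_induct)
    case (step n)
    \<comment> \<open>The one-sided estimate makes no assumption on signs, so it applies to the
      negated sequence.\<close>
    have "- L (Suc n) / d ^ Suc n + e / ((d - 1) * d ^ Suc n) \<le> - L n / d ^ n + e / ((d - 1) * d ^ n)"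
      by (rule quasi_geometric_upper[OF d e, of k "\<lambda>n. - L n"]) (use low step in auto)
    then show ?case using step by linarith
  qed simp
  have "L k / d ^ k - e / ((d - 1) * d ^ k) \<le> L n / d ^ n" if "n \<ge> k" for n
  proof -
    have "0 \<le> e / ((d - 1) * d ^ n)" using d e by simp
    then show ?thesis using dec[OF that] by simp
  qed
  then have "L k / d ^ k - e / ((d - 1) * d ^ k) \<le> g" by (intro LIMSEQ_le_const[OF g(1)]) blast
  then show ?thesis using g by (intro exI[of _ g]) (simp add: abs_le_iff)
qed

section \<open>Growth of an orbit under a single absolute value\<close>

locale local_orbit = abs_val w for w :: "'a::field \<Rightarrow> real" +
  fixes d m :: nat and l c :: "nat \<Rightarrow> 'a"
  assumes m: "m \<ge> 2" and d: "d > m"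
begin

abbreviation x where "x n i \<equiv> Phi_orbit d m l c n i"

text \<open>Index 0 contributes the value 1 here and in \<open>\<Lambda>\<close>, so both maxima are
  at least 1 and their logarithms are nonnegative.\<close>

definition M where "M n = (MAX i\<in>{..m}. w (x n i))"
definition \<Lambda> where "\<Lambda> = (MAX i\<in>{..m}. w (affine_point l i))"

lemma M_ge: "i \<le> m \<Longrightarrow> w (x n i) \<le> M n"
  unfolding M_def by (intro Max_ge) auto

lemma M_ge_1: "1 \<le> M n"
  using M_ge[of 0 n] by simp

lemma M_le:
  assumes "1 \<le> b" "\<And>i. i \<in> {1..m} \<Longrightarrow> w (x n i) \<le> b"
  shows "M n \<le> b"
proof -
  have "w (x n i) \<le> b" if "i \<le> m" for i
    using assms that by (cases "i = 0") auto
  then show ?thesis unfolding M_def by (subst Max_le_iff) auto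
qed

lemma M_attained:
  assumes "M n > 1"
  obtains i where "i \<in> {1..m}" "w (x n i) = M n"
proof -
  have "M n \<in> (\<lambda>i. w (x n i)) ` {..m}" unfolding M_def by (intro Max_in) auto
  then obtain i where i: "i \<le> m" "M n = w (x n i)" by auto
  then have "i \<noteq> 0" using assms by (metis less_irrefl one Phi_orbit_coord_0)
  then show ?thesis using i that[of i] by simp
qed

lemma \<Lambda>_ge: "j \<in> {1..m} \<Longrightarrow> w (l j) \<le> \<Lambda>"
proof -
  assume j: "j \<in> {1..m}"
  then have "w (affine_point l j) \<le> \<Lambda>" unfolding \<Lambda>_def by (intro Max_ge) auto
  then show ?thesis using j by (auto simp: affine_point_def)
qed

lemma \<Lambda>_ge_1: "1 \<le> \<Lambda>"
  unfolding \<Lambda>_def by (rule order.trans[OF _ Max_ge[of _ "w (affine_point l 0)"]]) (auto simp: affine_point_def)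

lemma \<Lambda>_le: "1 \<le> b \<Longrightarrow> (\<And>i. i \<in> {1..m} \<Longrightarrow> w (l i) \<le> b) \<Longrightarrow> \<Lambda> \<le> b"
  unfolding \<Lambda>_def by (subst Max_le_iff) (auto simp: affine_point_def)

abbreviation tail where "tail y \<equiv> (\<Sum>j=1..m. l j * y ^ (m - j))"

lemma tail_term:
  assumes "w y \<le> b" "1 \<le> b" "j \<in> {1..m}"
  shows "w (l j * y ^ (m - j)) \<le> \<Lambda> * b ^ (m - 1)"
proof -
  have "w y ^ (m - j) \<le> b ^ (m - 1)"
    using assms by (intro order.trans[OF power_mono power_increasing]) auto
  then show ?thesis unfolding mult power using \<Lambda>_ge[OF assms(3)] \<Lambda>_ge_1 by (intro mult_mono) auto
qed

lemma tail_le: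
  assumes "w y \<le> b" "1 \<le> b"
  shows "w (tail y) \<le> real m * \<Lambda> * b ^ (m - 1)"
proof -
  have "w (tail y) \<le> (\<Sum>j=1..m. w (l j * y ^ (m - j)))" by (rule sum_triangle)
  also have "\<dots> \<le> (\<Sum>j=1..m. \<Lambda> * b ^ (m - 1))" using tail_term[OF assms] by (intro sum_mono)
  finally show ?thesis by simp
qed

lemma step_le:
  assumes "w y \<le> b" "1 \<le> b"
  shows "w (y ^ d + tail y) \<le> b ^ d + real m * \<Lambda> * b ^ (m - 1)"
proof -
  have "w (y ^ d) \<le> b ^ d" unfolding power using assms by (intro power_mono) auto
  then show ?thesis using triangle[of "y ^ d" "tail y"] tail_le[OF assms] by linarith
qed

text \<open>A crude estimate that holds from index 0 on without comparing \<open>M n\<close> to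
  \<open>\<Lambda>\<close>; it serves when \<open>\<Lambda>\<close> is small.\<close>

lemma M_Suc_le: "M (Suc n) \<le> (1 + real m * \<Lambda>) * M n ^ d"
proof (rule M_le)
  have p: "1 \<le> M n ^ d" using M_ge_1 by simp
  then show "1 \<le> (1 + real m * \<Lambda>) * M n ^ d" using \<Lambda>_ge_1 m
    by (simp add: algebra_simps add_increasing2)
  fix i assume i: "i \<in> {1..m}"
  have "w (x (Suc n) i) \<le> M n ^ d + real m * \<Lambda> * M n ^ (m - 1)"
    using step_le[OF M_ge[of i n] M_ge_1] i by (simp add: Phi_orbit_Suc)
  also have "\<dots> \<le> M n ^ d + real m * \<Lambda> * M n ^ d"
    using M_ge_1[of n] \<Lambda>_ge_1 d by (intro add_left_mono mult_left_mono power_increasing) auto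
  finally show "w (x (Suc n) i) \<le> (1 + real m * \<Lambda>) * M n ^ d" by (simp add: algebra_simps)
qed

end

text \<open>
  \<open>b\<close> is the inverse of the Vandermonde matrix of \<open>c\<close>; it recovers the parameters \<open>l\<close> from the first iterate.
  The comparison factor \<open>A\<close> has logarithm linear in \<open>d\<close>, which the division by \<open>d\<close> in the canonical height
  absorbs; this is why the final bound does not depend on \<open>d\<close>.
\<close>

locale local_orbit_bounded = local_orbit +
  fixes b :: "nat \<Rightarrow> nat \<Rightarrow> 'a" and B :: real
  assumes B: "1 \<le> B" and c_le: "i \<in> {1..m} \<Longrightarrow> w (c i) \<le> B"
    and b_le: "i \<in> {1..m} \<Longrightarrow> j \<in> {1..m} \<Longrightarrow> w (b j i) \<le> B"
    and inverse: "j \<in> {1..m} \<Longrightarrow> k \<in> {1..m} \<Longrightarrow>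
      (\<Sum>i=1..m. b j i * c i ^ (m - k)) = (if j = k then 1 else 0)"
begin

text \<open>The numbers \<open>x 1 i - c i ^ d\<close> are the right-hand sides of the Vandermonde
  system for the parameters, which \<open>b\<close> inverts.\<close>

lemma l_eq:
  assumes j: "j \<in> {1..m}"
  shows "l j = (\<Sum>i=1..m. b j i * (x 1 i - c i ^ d))"
proof -
  have "(\<Sum>i=1..m. b j i * (x 1 i - c i ^ d)) = (\<Sum>i=1..m. \<Sum>k=1..m. l k * (b j i * c i ^ (m - k)))"
    using Phi_orbit_Suc[of _ d m l c 0]
    by (intro sum.cong) (auto simp: Phi_orbit_start sum_distrib_left mult_ac)
  also have "\<dots> = (\<Sum>k=1..m. l k * (\<Sum>i=1..m. b j i * c i ^ (m - k)))"
    by (subst sum.swap) (simp add: sum_distrib_left)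
  also have "\<dots> = (\<Sum>k=1..m. l k * (if j = k then 1 else 0))"
    by (intro sum.cong refl) (simp only: inverse[OF j])
  also have "\<dots> = l j" using j by (simp add: if_distrib cong: if_cong)
  finally show ?thesis by simp
qed

text \<open>B^(2d) dominates the powers of B that occur, with exponents d, m - 1 and d + 1; the
  factor 2 m covers m summands with two contributions each.\<close>

definition A where "A = 2 * real m * B ^ (2 * d)"

lemma A_ge: "2 * real m \<le> A" "1 \<le> A"
proof -
  have "2 * real m * 1 \<le> A" unfolding A_def using B by (intro mult_left_mono) auto
  then show "2 * real m \<le> A" "1 \<le> A" using m by auto
qed

lemma M_1_le: "M 1 \<le> A * \<Lambda>"
proof (rule M_le)
  show "1 \<le> A * \<Lambda>" using A_ge(2) \<Lambda>_ge_1 by (metis mult_mono' mult_1 zero_le_one)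
  fix i assume i: "i \<in> {1..m}"
  have BB: "B ^ d \<le> B ^ (2 * d)" "B ^ (m - 1) \<le> B ^ (2 * d)" using B d by (auto intro!: power_increasing)
  have "w (x 1 i) \<le> B ^ d + real m * \<Lambda> * B ^ (m - 1)"
    using step_le[OF c_le[OF i] B] i by (simp add: Phi_orbit_Suc Phi_orbit_start)
  also have "\<dots> \<le> real m * \<Lambda> * B ^ (2 * d) + real m * \<Lambda> * B ^ (2 * d)"
  proof (intro add_mono mult_left_mono BB)
    have "1 * 1 \<le> real m * \<Lambda>" using m \<Lambda>_ge_1 by (intro mult_mono) auto
    then have "1 * B ^ d \<le> real m * \<Lambda> * B ^ (2 * d)" using BB B by (intro mult_mono) auto
    then show "B ^ d \<le> real m * \<Lambda> * B ^ (2 * d)" by simp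
  qed (use \<Lambda>_ge_1 in auto)
  finally show "w (x 1 i) \<le> A * \<Lambda>" by (simp add: A_def mult_ac)
qed

lemma \<Lambda>_le_M_1: "\<Lambda> \<le> A * M 1"
proof (rule \<Lambda>_le)
  show "1 \<le> A * M 1" using A_ge(2) M_ge_1 by (metis mult_mono' mult_1 zero_le_one)
  fix j assume j: "j \<in> {1..m}"
  have "w (l j) \<le> (\<Sum>i=1..m. w (b j i * (x 1 i - c i ^ d)))"
    unfolding l_eq[OF j] by (rule sum_triangle)
  also have "\<dots> \<le> (\<Sum>i=1..m. B * (2 * B ^ d * M 1))"
  proof (rule sum_mono)
    fix i assume i: "i \<in> {1..m}"
    have "w (x 1 i - c i ^ d) \<le> M 1 + B ^ d"
      using diff_triangle[of "x 1 i" "c i ^ d"] M_ge[of i 1] i power_mono[OF c_le[OF i] nonneg, of d]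
      by (simp add: power)
    also have "\<dots> \<le> B ^ d * M 1 + B ^ d * M 1"
      using M_ge_1[of 1] B by (intro add_mono) simp_all
    finally have "w (x 1 i - c i ^ d) \<le> 2 * B ^ d * M 1" by simp
    then show "w (b j i * (x 1 i - c i ^ d)) \<le> B * (2 * B ^ d * M 1)"
      unfolding mult using b_le[OF i j] B by (intro mult_mono) auto
  qed
  also have "\<dots> = 2 * real m * M 1 * B ^ Suc d" by simp
  also have "\<dots> \<le> 2 * real m * M 1 * B ^ (2 * d)"
    using B d m M_ge_1[of 1] by (intro mult_left_mono power_increasing) auto
  finally show "w (l j) \<le> A * M 1" by (simp add: A_def mult_ac)
qed

lemma ln_A: "ln A = ln (2 * real m) + 2 * real d * ln B"
  unfolding A_def using B m by (simp add: ln_mult ln_realpow)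

text \<open>The threshold gives R = \<Lambda> / A, a lower bound for \<open>M 1\<close>, the
  property R^2 \<ge> 2 m \<Lambda>. While M k \<ge> R, the lower terms are at most m \<Lambda> M
  k^(m - 1) and so at most half of M k^(m + 1).\<close>

lemma archimedean_step:
  assumes large: "2 * real m * A\<^sup>2 \<le> \<Lambda>" and "n \<ge> 1"
  shows "\<Lambda> / A \<le> M n \<and> M (Suc n) \<le> 2 * M n ^ d \<and> M n ^ d \<le> 2 * M (Suc n)"
proof -
  define R where "R = \<Lambda> / A"
  have A0: "A > 0" using A_ge by linarith
  have R: "2 * real m * A \<le> R" using large A0 by (simp add: R_def field_simps power2_eq_square)
  have "1 * 2 \<le> (2 * real m) * A" using m A_ge by (intro mult_mono) auto
  then have R2: "2 \<le> R" using R by linarith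
  have "2 * real m * A\<^sup>2 * \<Lambda> \<le> \<Lambda> * \<Lambda>" using large \<Lambda>_ge_1 by (intro mult_right_mono) auto
  then have Rsq: "2 * real m * \<Lambda> \<le> R\<^sup>2" using A0 by (simp add: R_def power_divide field_simps power2_eq_square)
  have step: "M (Suc k) \<le> 2 * M k ^ d \<and> M k ^ d \<le> 2 * M (Suc k) \<and> R \<le> M (Suc k)" if k: "R \<le> M k" for k
  proof -
    have Mk: "2 \<le> M k" "1 \<le> M k" using k R2 by linarith+
    have "2 * real m * \<Lambda> \<le> (M k)\<^sup>2" using Rsq k R2 by (metis order.trans power_mono zero_le_numeral)
    then have "2 * real m * \<Lambda> * M k ^ (m - 1) \<le> (M k)\<^sup>2 * M k ^ (m - 1)" using Mk by (intro mult_right_mono) auto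
    also have "\<dots> = M k ^ Suc m" using m by (simp flip: power_add)
    \<comment> \<open>Here \<open>d > m\<close> enters, in the form d \<ge> m + 1.\<close>
    also have "\<dots> \<le> M k ^ d" using d Mk by (intro power_increasing) auto
    finally have small: "real m * \<Lambda> * M k ^ (m - 1) \<le> M k ^ d / 2" by simp
    have "M (Suc k) \<le> 2 * M k ^ d"
    proof (rule M_le)
      have "1 \<le> M k ^ d" using Mk by simp
      then show "1 \<le> 2 * M k ^ d" by simp
      fix i assume "i \<in> {1..m}"
      then have "w (x (Suc k) i) \<le> M k ^ d + real m * \<Lambda> * M k ^ (m - 1)"
        using step_le[OF M_ge[of i k] M_ge_1] by (simp add: Phi_orbit_Suc)
      then show "w (x (Suc k) i) \<le> 2 * M k ^ d" using small \<open>1 \<le> M k ^ d\<close> by linarith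
    qed
    moreover have low: "M k ^ d \<le> 2 * M (Suc k)"
    proof -
      obtain i where i: "i \<in> {1..m}" "w (x k i) = M k" using M_attained[of k] Mk by auto
      have "M k ^ d = w (x (Suc k) i - tail (x k i))" using i by (simp add: Phi_orbit_Suc power)
      also have "\<dots> \<le> w (x (Suc k) i) + w (tail (x k i))" by (rule diff_triangle)
      also have "\<dots> \<le> M (Suc k) + M k ^ d / 2"
        using M_ge[of i "Suc k"] i tail_le[of "x k i" "M k"] Mk small by auto
      finally show ?thesis by simp
    qed
    moreover have "R \<le> M (Suc k)"
    proof -
      \<comment> \<open>The bound R persists: M k \<ge> 2 gives 2 M k \<le> M k^2 \<le> M k^d \<le>
        2 M (k + 1).\<close>
      have "2 * M k \<le> M k * M k" using Mk by (intro mult_right_mono) auto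
      also have "\<dots> = M k ^ 2" by (simp add: power2_eq_square)
      also have "\<dots> \<le> M k ^ d" using Mk m d by (intro power_increasing) auto
      finally show ?thesis using low k by linarith
    qed
    ultimately show ?thesis by blast
  qed
  have "R \<le> M n" using \<open>n \<ge> 1\<close>
  proof (induction n rule: dec_induct)
    case base
    show ?case using \<Lambda>_le_M_1 A0 by (simp add: R_def field_simps)
  next
    case (step n)
    then show ?case using \<open>\<And>k. R \<le> M k \<Longrightarrow> _\<close> by blast
  qed
  then show ?thesis using step by (simp add: R_def)
qed

lemma ln_M_nonneg: "0 \<le> ln (M n)"
  using M_ge_1 by simp

text \<open>The estimates rest on the triangle inequality alone, so they cover every exceptional
  place, archimedean or not. Above the threshold the limit follows ln (M 1) / d; below it, the limit
  and ln \<Lambda> / d are bounded separately.\<close>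

lemma archimedean_limit:
  "\<exists>g. (\<lambda>n. ln (M n) / real d ^ n) \<longlonglongrightarrow> g \<and> \<bar>g - ln \<Lambda> / real d\<bar> \<le> 4 * ln (2 * real m) + 9 * ln B"
proof -
  have d3: "real d \<ge> 3" and d1: "real d > 1" using m d by auto
  have m4: "2 * real m \<ge> 4" using m by simp
  then have lnm: "ln (2 * real m) \<ge> ln 2" "ln (2 * real m) \<ge> 0" by auto
  have lnB: "ln B \<ge> 0" using B by simp
  have ln2: "ln (2::real) \<ge> 0" by simp
  have pos: "M n > 0" "\<Lambda> > 0" "A > 0" for n using M_ge_1[of n] \<Lambda>_ge_1 A_ge by linarith+
  have div_le: "t / real d \<le> t" if "t \<ge> 0" for t using that d3 by (simp add: divide_le_eq mult_le_cancel_left1)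
  show ?thesis
  proof (cases "2 * real m * A\<^sup>2 \<le> \<Lambda>")
    case True
    have "\<bar>ln (M (Suc n)) - real d * ln (M n)\<bar> \<le> ln 2" if "n \<ge> 1" for n
    proof -
      have "ln (M (Suc n)) \<le> ln (2 * M n ^ d)" "ln (M n ^ d) \<le> ln (2 * M (Suc n))"
        using archimedean_step[OF True that] pos by (simp_all add: ln_le_cancel_iff)
      then show ?thesis using pos(1)[of n] pos(1)[of "Suc n"] by (simp add: ln_mult ln_realpow abs_le_iff)
    qed
    \<comment> \<open>The comparison starts at index 1, the first iterate in which the parameters
      appear.\<close>
    from quasi_geometric_limit_two_sided[where L = "\<lambda>n. ln (M n)" and k = 1, OF d1 ln2 ln_M_nonneg this]
    obtain g where g: "(\<lambda>n. ln (M n) / real d ^ n) \<longlonglongrightarrow> g"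
        "\<bar>g - ln (M 1) / real d\<bar> \<le> ln 2 / ((real d - 1) * real d)" by auto
    have "ln 2 / ((real d - 1) * real d) \<le> ln 2 / 1"
    proof (rule divide_left_mono)
      have "1 * 1 \<le> (real d - 1) * real d" using d3 by (intro mult_mono) auto
      then show "1 \<le> (real d - 1) * real d" "0 < (real d - 1) * real d * 1" by simp_all
    qed simp
    moreover have "\<bar>ln (M 1) - ln \<Lambda>\<bar> \<le> ln A"
    proof -
      have "ln (M 1) \<le> ln (A * \<Lambda>)" "ln \<Lambda> \<le> ln (A * M 1)"
        using M_1_le \<Lambda>_le_M_1 pos by (simp_all add: ln_le_cancel_iff)
      then show ?thesis using pos(1)[of 1] pos(2,3) by (simp add: ln_mult abs_le_iff)
    qed
    then have "\<bar>ln (M 1) / real d - ln \<Lambda> / real d\<bar> \<le> ln A / real d"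
      using d3 by (simp add: diff_divide_distrib[symmetric] divide_right_mono)
    moreover have "ln A / real d \<le> ln (2 * real m) + 2 * ln B"
      using div_le[OF lnm(2)] d3 by (simp add: ln_A add_divide_distrib)
    ultimately have "\<bar>g - ln \<Lambda> / real d\<bar> \<le> ln 2 + ln (2 * real m) + 2 * ln B"
      using g(2) by linarith
    then show ?thesis using g(1) lnm lnB by (intro exI[of _ g]) auto
  next
    case False
    define e where "e = ln (1 + real m * \<Lambda>)"
    have m\<Lambda>: "1 * 1 \<le> real m * \<Lambda>" using m \<Lambda>_ge_1 by (intro mult_mono) auto
    then have e: "e \<ge> 0" by (simp add: e_def)
    have "ln (M (Suc n)) \<le> real d * ln (M n) + e" for n
    proof -
      have "ln (M (Suc n)) \<le> ln ((1 + real m * \<Lambda>) * M n ^ d)"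
        using M_Suc_le[of n] pos(1)[of "Suc n"] by (intro ln_mono) auto
      then show ?thesis using pos(1)[of n] m\<Lambda> by (simp add: ln_mult ln_realpow e_def)
    qed
    from quasi_geometric_limit[where L = "\<lambda>n. ln (M n)" and k = 0, OF d1 e ln_M_nonneg this]
    obtain g where g: "(\<lambda>n. ln (M n) / real d ^ n) \<longlonglongrightarrow> g" "0 \<le> g"
        "g \<le> ln (M 0) + e / (real d - 1)" by auto
    \<comment> \<open>Below the threshold ln \<Lambda> is at most linear in d, which division by d
      or d - 1 makes harmless.\<close>
    have \<Lambda>: "ln \<Lambda> \<le> 3 * ln (2 * real m) + 4 * real d * ln B"
    proof -
      have "ln \<Lambda> \<le> ln (2 * real m * A\<^sup>2)" using False pos by simp
      also have "\<dots> = ln (2 * real m) + 2 * ln A" using m pos by (simp add: ln_mult ln_realpow)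
      finally show ?thesis by (simp add: ln_A)
    qed
    have "ln (M 0) \<le> ln B"
      using pos(1)[of 0] M_le[OF B, of 0] c_le by (intro ln_mono) (simp_all add: Phi_orbit_start)
    moreover have "e / (real d - 1) \<le> 4 * ln (2 * real m) + 8 * ln B"
    proof -
      have "e \<le> ln (2 * real m * \<Lambda>)" unfolding e_def using m\<Lambda> by (intro ln_mono) auto
      also have "\<dots> = ln (2 * real m) + ln \<Lambda>" using m pos by (simp add: ln_mult)
      finally have "e \<le> 4 * ln (2 * real m) + 4 * real d * ln B" using \<Lambda> by simp
      also have "\<dots> \<le> 4 * ln (2 * real m) * (real d - 1) + 8 * ln B * (real d - 1)"
      proof (rule add_mono)
        show "4 * ln (2 * real m) \<le> 4 * ln (2 * real m) * (real d - 1)"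
          using lnm d3 by (simp add: mult_le_cancel_left1)
        \<comment> \<open>As d \<ge> 3, d is at most 2 (d - 1), which turns 4 into 8; the ninth ln B
          comes from the starting point.\<close>
        have "4 * ln B * real d \<le> 4 * ln B * (2 * (real d - 1))" using lnB d3 by (intro mult_left_mono) auto
        then show "4 * real d * ln B \<le> 8 * ln B * (real d - 1)" by (simp add: algebra_simps)
      qed
      finally show ?thesis using d3 by (simp add: divide_le_eq algebra_simps)
    qed
    ultimately have "g \<le> 4 * ln (2 * real m) + 9 * ln B" using g(3) by linarith
    moreover have "ln \<Lambda> / real d \<le> 3 * ln (2 * real m) + 4 * ln B"
    proof -
      have "ln \<Lambda> / real d \<le> (3 * ln (2 * real m) + 4 * real d * ln B) / real d"
        using \<Lambda> d3 by (intro divide_right_mono) auto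
      also have "\<dots> = 3 * ln (2 * real m) / real d + 4 * ln B" using d3 by (simp add: add_divide_distrib)
      finally show ?thesis using div_le[of "3 * ln (2 * real m)"] lnm by simp
    qed
    moreover have "0 \<le> ln \<Lambda> / real d" using \<Lambda>_ge_1 by simp
    ultimately have "\<bar>g - ln \<Lambda> / real d\<bar> \<le> 4 * ln (2 * real m) + 9 * ln B"
      using g(2) lnm lnB by (auto simp: abs_le_iff)
    then show ?thesis using g(1) by blast
  qed
qed

end

section \<open>Exact growth at the good ultrametric places\<close>

locale local_orbit_ultra = local_orbit_bounded w d m l c b 1 + ultra_abs_val w
  for w :: "'a::field \<Rightarrow> real" and d m l c b
begin

text \<open>With \<open>c\<close> and \<open>b\<close> integral, both comparisons of
  \<open>M 1\<close> and \<open>\<Lambda>\<close> hold with factor 1.\<close>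

lemma M_1_ultra: "M 1 = \<Lambda>"
proof (rule antisym)
  show "M 1 \<le> \<Lambda>"
  proof (rule M_le[OF \<Lambda>_ge_1])
    fix i assume i: "i \<in> {1..m}"
    have "w (tail (c i)) \<le> \<Lambda>"
      using tail_term[OF c_le[OF i]] \<Lambda>_ge_1 by (intro ultra_sum) auto
    moreover have "w (c i ^ d) \<le> 1" using c_le[OF i] by (simp add: power power_le_one)
    ultimately show "w (x 1 i) \<le> \<Lambda>"
      using ultra[of "c i ^ d" "tail (c i)"] \<Lambda>_ge_1 i by (simp add: Phi_orbit_Suc Phi_orbit_start)
  qed
  show "\<Lambda> \<le> M 1"
  proof (rule \<Lambda>_le[OF M_ge_1])
    fix j assume j: "j \<in> {1..m}"
    show "w (l j) \<le> M 1"
      unfolding l_eq[OF j]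
    proof (rule ultra_sum)
      fix i assume i: "i \<in> {1..m}"
      have "w (c i ^ d) \<le> 1" using c_le[OF i] by (simp add: power power_le_one)
      then have "w (x 1 i - c i ^ d) \<le> M 1"
        using ultra_diff[of "x 1 i" "c i ^ d"] M_ge[of i 1] M_ge_1[of 1] i by auto
      then have "w (b j i) * w (x 1 i - c i ^ d) \<le> 1 * M 1"
        using b_le[OF i j] by (intro mult_mono) auto
      then show "w (b j i * (x 1 i - c i ^ d)) \<le> M 1" by (simp add: mult)
    qed (use M_ge_1[of 1] in simp)
  qed
qed

text \<open>If \<open>M n > 1\<close>, the lower terms are at most \<open>M n ^ m\<close>, strictly
  below the leading power, so nothing cancels in a coordinate that attains the maximum. If
  \<open>M n = 1\<close>, the lower bound is trivial.\<close>

lemma M_Suc_ultra: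
  assumes "\<Lambda> \<le> M n"
  shows "M (Suc n) = M n ^ d"
proof (rule antisym)
  have tail: "w (tail (x n i)) \<le> M n ^ m" if "i \<le> m" for i
  proof (rule ultra_sum)
    fix j assume "j \<in> {1..m}"
    then have "w (l j * x n i ^ (m - j)) \<le> \<Lambda> * M n ^ (m - 1)"
      using that by (intro tail_term M_ge M_ge_1)
    also have "\<dots> \<le> M n * M n ^ (m - 1)" using assms M_ge_1[of n] by (intro mult_right_mono) auto
    also have "\<dots> = M n ^ m" using m by (simp flip: power_Suc)
    finally show "w (l j * x n i ^ (m - j)) \<le> M n ^ m" .
  qed (use M_ge_1[of n] in simp)
  have md: "M n ^ m \<le> M n ^ d" using M_ge_1 d by (intro power_increasing) auto
  show "M (Suc n) \<le> M n ^ d"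
  proof (rule M_le)
    show "1 \<le> M n ^ d" using M_ge_1 by simp
    fix i assume i: "i \<in> {1..m}"
    have "w (x n i ^ d) \<le> M n ^ d" unfolding power using i by (intro power_mono M_ge) auto
    then show "w (x (Suc n) i) \<le> M n ^ d"
      using ultra[of "x n i ^ d" "tail (x n i)"] tail[of i] md i by (simp add: Phi_orbit_Suc)
  qed
  show "M n ^ d \<le> M (Suc n)"
  proof (cases "M n > 1")
    case True
    obtain i where i: "i \<in> {1..m}" "w (x n i) = M n" using M_attained[OF True] .
    have "M n ^ m < M n ^ d" using True d by (simp add: power_strict_increasing)
    then have "w (tail (x n i)) < w (x n i ^ d)" using tail[of i] i by (simp add: power)
    then have "w (x (Suc n) i) = M n ^ d" using ultra_dominant i by (simp add: Phi_orbit_Suc power)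
    then show ?thesis using M_ge[of i "Suc n"] i by simp
  next
    case False
    then have "M n = 1" using M_ge_1[of n] by simp
    then show ?thesis using M_ge_1 by simp
  qed
qed

lemma ultra_limit: "(\<lambda>n. ln (M n) / real d ^ n) \<longlonglongrightarrow> ln \<Lambda> / real d"
proof -
  \<comment> \<open>At index 0 all coordinates are integral, so in general the comparison can only
    start at index 1.\<close>
  have \<Lambda>: "\<Lambda> \<le> M n" if "n \<ge> 1" for n
    using that
  proof (induction n rule: dec_induct)
    case base
    then show ?case using M_1_ultra by simp
  next
    case (step n)
    have "M n ^ 1 \<le> M n ^ d" using M_ge_1 d by (intro power_increasing) auto
    then show ?case using step M_Suc_ultra[of n] by simp
  qed
  have "\<bar>ln (M (Suc n)) - real d * ln (M n)\<bar> \<le> 0" if "n \<ge> 1" for n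
    using M_Suc_ultra[OF \<Lambda>[OF that]] M_ge_1[of n] by (simp add: ln_realpow)
  then obtain g where "(\<lambda>n. ln (M n) / real d ^ n) \<longlonglongrightarrow> g" "\<bar>g - ln (M 1) / real d ^ 1\<bar> \<le> 0 / ((real d - 1) * real d ^ 1)"
    using quasi_geometric_limit_two_sided[of "real d" 0 "\<lambda>n. ln (M n)" 1] ln_M_nonneg m d by auto
  then show ?thesis using M_1_ultra by simp
qed

text \<open>This holds for all n at once, so a single finite set of places carries the heights of
  all iterates.\<close>

lemma M_trivial:
  assumes "\<Lambda> = 1"
  shows "M n = 1"
proof (induction n)
  case 0
  then show ?case using M_le[of 1 0] M_ge_1[of 0] c_le by (simp add: Phi_orbit_start)
next
  case (Suc n)
  then show ?case using M_Suc_ultra[of n] assms by simp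
qed

end

section \<open>The generic height\<close>

definition exp_deg :: "(nat \<Rightarrow>\<^sub>0 nat) \<Rightarrow> nat" where
  "exp_deg e = (\<Sum>i\<in>Poly_Mapping.keys e. Poly_Mapping.lookup e i)"

lemma total_deg_alt: "total_deg p = Max (insert 0 (exp_deg ` Poly_Mapping.keys p))"
  by (simp add: total_deg_def exp_deg_def)

lemma exp_deg_superset:
  "finite I \<Longrightarrow> Poly_Mapping.keys e \<subseteq> I \<Longrightarrow> exp_deg e = (\<Sum>i\<in>I. Poly_Mapping.lookup e i)"
  unfolding exp_deg_def by (rule sum.mono_neutral_left) (auto simp: in_keys_iff)

lemma exp_deg_add: "exp_deg (a + b) = exp_deg a + exp_deg b"
proof -
  let ?I = "Poly_Mapping.keys a \<union> Poly_Mapping.keys b"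
  have "Poly_Mapping.keys (a + b) \<subseteq> ?I" by (rule keys_add)
  then show ?thesis
    using exp_deg_superset[of ?I a] exp_deg_superset[of ?I b] exp_deg_superset[of ?I "a + b"]
    by (simp add: lookup_add sum.distrib)
qed

lemma total_deg_leI: "(\<And>e. e \<in> Poly_Mapping.keys p \<Longrightarrow> exp_deg e \<le> D) \<Longrightarrow> total_deg p \<le> D"
  unfolding total_deg_alt by (subst Max_le_iff) auto

lemma exp_deg_le_total_deg: "e \<in> Poly_Mapping.keys p \<Longrightarrow> exp_deg e \<le> total_deg p"
  unfolding total_deg_alt by (rule Max_ge) auto

lemma total_deg_attained:
  assumes "p \<noteq> 0"
  obtains e where "e \<in> Poly_Mapping.keys p" "exp_deg e = total_deg p"
proof -
  have ne: "Poly_Mapping.keys p \<noteq> {}" using assms by simp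
  have "Max (exp_deg ` Poly_Mapping.keys p) \<in> exp_deg ` Poly_Mapping.keys p" using ne by (intro Max_in) auto
  then obtain e where e: "e \<in> Poly_Mapping.keys p" "exp_deg e = Max (exp_deg ` Poly_Mapping.keys p)" by auto
  have "total_deg p \<le> exp_deg e" unfolding e(2) by (intro total_deg_leI Max_ge) auto
  then show ?thesis using that e(1) exp_deg_le_total_deg[OF e(1)] by (metis order_antisym)
qed

lemma total_deg_0 [simp]: "total_deg 0 = 0"
  by (simp add: total_deg_alt)

lemma total_deg_single_le: "total_deg (Poly_Mapping.single e a) \<le> exp_deg e"
  by (rule total_deg_leI) (simp split: if_splits)

lemma total_deg_add_le: "total_deg (p + q) \<le> max (total_deg p) (total_deg q)"
proof (rule total_deg_leI)
  fix e assume "e \<in> Poly_Mapping.keys (p + q)"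
  then have "e \<in> Poly_Mapping.keys p \<or> e \<in> Poly_Mapping.keys q" using keys_add[of p q] by blast
  then show "exp_deg e \<le> max (total_deg p) (total_deg q)"
    using exp_deg_le_total_deg[of e p] exp_deg_le_total_deg[of e q] by auto
qed

lemma total_deg_sum_le: "(\<And>i. i \<in> I \<Longrightarrow> total_deg (f i) \<le> D) \<Longrightarrow> total_deg (sum f I) \<le> D"
  by (induction I rule: infinite_finite_induct) (auto intro: order.trans[OF total_deg_add_le])

lemma total_deg_mult_le: "total_deg (p * q) \<le> total_deg p + total_deg q"
proof (rule total_deg_leI)
  fix e assume "e \<in> Poly_Mapping.keys (p * q)"
  then obtain a b where "e = a + b" "a \<in> Poly_Mapping.keys p" "b \<in> Poly_Mapping.keys q"
    using keys_mult[of p q] by blast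
  then show "exp_deg e \<le> total_deg p + total_deg q"
    using exp_deg_le_total_deg[of a p] exp_deg_le_total_deg[of b q] by (simp add: exp_deg_add)
qed

lemma total_deg_power_le: "total_deg (p ^ n) \<le> n * total_deg (p :: 'b::comm_semiring_1 mpolys)"
proof (induction n)
  case 0
  have "total_deg (1 :: 'b mpolys) \<le> exp_deg 0"
    using total_deg_single_le[of 0 "1::'b"] by simp
  then show ?case by (simp add: exp_deg_def)
next
  case (Suc n)
  then show ?case using total_deg_mult_le[of p "p ^ n"] by simp
qed

lemma total_deg_add_eq:
  fixes p q :: "'b::comm_ring_1 mpolys"
  assumes "total_deg q < total_deg p"
  shows "total_deg (p + q) = total_deg p"
proof -
  have "total_deg (- q) = total_deg q"
  proof -
    have "Poly_Mapping.keys (- q) = Poly_Mapping.keys q" by (auto simp: in_keys_iff)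
    then show ?thesis by (simp add: total_deg_alt)
  qed
  then have "total_deg p \<le> max (total_deg (p + q)) (total_deg q)"
    using total_deg_add_le[of "p + q" "- q"] by simp
  then show ?thesis using total_deg_add_le[of p q] assms by simp
qed

text \<open>The homogeneous component of highest degree.\<close>

definition top_part :: "'b::comm_ring_1 mpolys \<Rightarrow> 'b mpolys" where
  "top_part p = Abs_poly_mapping (\<lambda>e. Poly_Mapping.lookup p e when exp_deg e = total_deg p)"

lemma lookup_top_part:
  "Poly_Mapping.lookup (top_part p) e = (Poly_Mapping.lookup p e when exp_deg e = total_deg p)"
proof -
  have "finite {e. (Poly_Mapping.lookup p e when exp_deg e = total_deg p) \<noteq> 0}"
    by (rule finite_subset[of _ "Poly_Mapping.keys p"]) (auto simp: in_keys_iff)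
  then show ?thesis unfolding top_part_def by simp
qed

text \<open>Over a domain the product of the top parts is nonzero. Its monomials have the full
  degree, and all other contributions have smaller degree, so they cannot cancel it.\<close>

lemma total_deg_mult:
  fixes p q :: "'b::idom mpolys"
  assumes "p \<noteq> 0" "q \<noteq> 0"
  shows "total_deg (p * q) = total_deg p + total_deg q"
proof (rule antisym[OF total_deg_mult_le])
  let ?T = "top_part p * top_part q" and ?D = "total_deg p + total_deg q"
  have keys_top: "e \<in> Poly_Mapping.keys (top_part r) \<Longrightarrow> exp_deg e = total_deg r" for e and r :: "'b mpolys"
    by (auto simp: in_keys_iff lookup_top_part when_def split: if_splits)
  have keys_rest: "e \<in> Poly_Mapping.keys (r - top_part r) \<Longrightarrow> exp_deg e < total_deg r" for e and r :: "'b mpolys"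
    using exp_deg_le_total_deg[of e r]
    by (cases "exp_deg e = total_deg r") (auto simp: in_keys_iff lookup_minus lookup_top_part when_def le_neq_implies_less)
  have top_nz: "top_part r \<noteq> 0" if r: "r \<noteq> 0" for r :: "'b mpolys"
  proof -
    obtain e where "e \<in> Poly_Mapping.keys r" "exp_deg e = total_deg r" using total_deg_attained[OF r] .
    then have "Poly_Mapping.lookup (top_part r) e \<noteq> 0" by (simp add: lookup_top_part in_keys_iff)
    then show ?thesis by auto
  qed
  have "?T \<noteq> 0" using top_nz assms by simp
  then obtain e where e: "e \<in> Poly_Mapping.keys ?T" using keys_eq_empty by blast
  obtain a b where "e = a + b" "a \<in> Poly_Mapping.keys (top_part p)" "b \<in> Poly_Mapping.keys (top_part q)"
    using e keys_mult[of "top_part p" "top_part q"] by blast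
  then have edeg: "exp_deg e = ?D" using keys_top by (simp add: exp_deg_add)
  have "e \<notin> Poly_Mapping.keys (top_part p * (q - top_part q))"
  proof
    assume "e \<in> Poly_Mapping.keys (top_part p * (q - top_part q))"
    then obtain a b where "e = a + b" "a \<in> Poly_Mapping.keys (top_part p)" "b \<in> Poly_Mapping.keys (q - top_part q)"
      using keys_mult[of "top_part p" "q - top_part q"] by blast
    then show False using keys_top[of a p] keys_rest[of b q] edeg by (simp add: exp_deg_add)
  qed
  moreover have "e \<notin> Poly_Mapping.keys ((p - top_part p) * q)"
  proof
    assume "e \<in> Poly_Mapping.keys ((p - top_part p) * q)"
    then obtain a b where "e = a + b" "a \<in> Poly_Mapping.keys (p - top_part p)" "b \<in> Poly_Mapping.keys q"
      using keys_mult[of "p - top_part p" q] by blast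
    then show False using keys_rest[of a p] exp_deg_le_total_deg[of b q] edeg by (simp add: exp_deg_add)
  qed
  moreover have "p * q = ?T + (top_part p * (q - top_part q) + (p - top_part p) * q)"
    by (simp add: algebra_simps)
  ultimately have "Poly_Mapping.lookup (p * q) e = Poly_Mapping.lookup ?T e"
    by (simp add: lookup_add in_keys_iff)
  then have "e \<in> Poly_Mapping.keys (p * q)" using e by (simp add: in_keys_iff)
  then show "?D \<le> total_deg (p * q)" using exp_deg_le_total_deg[of e "p * q"] edeg by simp
qed

lemma total_deg_1 [simp]: "total_deg (1 :: 'b::comm_semiring_1 mpolys) = 0"
  using total_deg_power_le[of "1 :: 'b mpolys" 0] by simp

lemma total_deg_power:
  fixes p :: "'b::idom mpolys"
  assumes "p \<noteq> 0"
  shows "total_deg (p ^ n) = n * total_deg p"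
  by (induction n) (simp_all add: total_deg_mult assms)

section \<open>The orbit over the polynomial ring in the parameters\<close>

lemma polys_in_1: "(1 :: 'b::comm_semiring_1 mpolys) \<in> polys_in m"
  unfolding polys_in_def by (auto simp flip: single_one split: if_splits)

lemma polys_in_single:
  "Poly_Mapping.keys e \<subseteq> {1..m} \<Longrightarrow> Poly_Mapping.single e a \<in> polys_in m"
  unfolding polys_in_def by (auto split: if_splits)

lemma polys_in_add: "p \<in> polys_in m \<Longrightarrow> q \<in> polys_in m \<Longrightarrow> p + q \<in> polys_in m"
  unfolding polys_in_def using keys_add[of p q] by blast

lemma polys_in_mult: "p \<in> polys_in m \<Longrightarrow> q \<in> polys_in m \<Longrightarrow> p * q \<in> polys_in m"
proof -
  assume pq: "p \<in> polys_in m" "q \<in> polys_in m"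
  have "Poly_Mapping.keys e \<subseteq> {1..m}" if "e \<in> Poly_Mapping.keys (p * q)" for e
  proof -
    obtain a b where "e = a + b" "a \<in> Poly_Mapping.keys p" "b \<in> Poly_Mapping.keys q"
      using keys_mult[of p q] \<open>e \<in> Poly_Mapping.keys (p * q)\<close> by blast
    then show ?thesis using pq keys_add[of a b] unfolding polys_in_def by blast
  qed
  then show ?thesis by (simp add: polys_in_def)
qed

lemma polys_in_power: "p \<in> polys_in m \<Longrightarrow> p ^ n \<in> polys_in (m::nat)"
  for p :: "'b::comm_semiring_1 mpolys"
  by (induction n) (auto intro: polys_in_1 polys_in_mult)

lemma polys_in_sum: "(\<And>i. i \<in> I \<Longrightarrow> f i \<in> polys_in m) \<Longrightarrow> sum f I \<in> polys_in m"
proof (induction I rule: infinite_finite_induct)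
  case (insert i I)
  then show ?case using polys_in_add[of "f i" m "sum f I"] by simp
qed (simp_all add: polys_in_def)

lemma frac_of_poly_hom:
  fixes p q :: "'b::idom mpolys"
  shows "frac_of_poly (p + q) = frac_of_poly p + frac_of_poly q"
    and "frac_of_poly (p * q) = frac_of_poly p * frac_of_poly q"
    and "frac_of_poly (0 :: 'b mpolys) = 0" and "frac_of_poly (1 :: 'b mpolys) = 1"
    and "frac_of_poly p = frac_of_poly q \<longleftrightarrow> p = q"
  by (simp_all add: frac_of_poly_def Zero_fract_def One_fract_def eq_fract)

lemma frac_of_poly_power: "frac_of_poly (p ^ n) = frac_of_poly p ^ n"
  by (induction n) (simp_all add: frac_of_poly_hom)

lemma frac_of_poly_sum: "frac_of_poly (sum f I) = (\<Sum>i\<in>I. frac_of_poly (f i))"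
  by (induction I rule: infinite_finite_induct) (simp_all add: frac_of_poly_hom)

text \<open>As the zeroth coordinate stays 1, the orbit over the function field has no denominators
  and can be followed in the polynomial ring.\<close>

definition generic_orbit :: "nat \<Rightarrow> nat \<Rightarrow> (nat \<Rightarrow> 'b::comm_ring_1) \<Rightarrow> nat \<Rightarrow> nat \<Rightarrow> 'b mpolys" where
  "generic_orbit d m c =
     Phi_orbit d m (\<lambda>j. Poly_Mapping.single (Poly_Mapping.single j 1) 1) (\<lambda>i. Poly_Mapping.single 0 (c i))"

lemma Phi_orbit_frac:
  fixes c :: "nat \<Rightarrow> 'b::idom"
  shows "Phi_orbit d m frac_var (\<lambda>i. frac_const (c i)) n i = frac_of_poly (generic_orbit d m c n i)"
proof (induction n arbitrary: i)
  case 0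
  then show ?case
    by (cases "i = 0") (simp_all add: generic_orbit_def Phi_orbit_start frac_of_poly_hom frac_const_def)
next
  case (Suc n)
  then show ?case
    by (cases "i = 0")
      (simp_all add: generic_orbit_def Phi_orbit_Suc frac_of_poly_hom frac_of_poly_power frac_of_poly_sum frac_var_def)
qed

lemma generic_orbit_in: "i \<le> m \<Longrightarrow> generic_orbit d m c n i \<in> polys_in m"
proof (induction n arbitrary: i)
  case 0
  then show ?case
    by (cases "i = 0") (simp_all add: generic_orbit_def Phi_orbit_start polys_in_1 polys_in_single)
next
  case (Suc n)
  then show ?case
    by (cases "i = 0")
      (auto simp: generic_orbit_def Phi_orbit_Suc polys_in_1
        intro!: polys_in_add polys_in_sum polys_in_mult polys_in_power polys_in_single)
qed

lemma single_0_power: "Poly_Mapping.single 0 a ^ n = (Poly_Mapping.single 0 (a ^ n) :: 'b::comm_semiring_1 mpolys)"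
  by (induction n) (simp_all add: mult_single)

lemma exp_deg_single: "exp_deg (Poly_Mapping.single j k) = k"
  by (simp add: exp_deg_def)

text \<open>The starting point is constant and the first iterate linear in the parameters;
  afterwards \<open>d > m\<close> keeps the d-th power ahead of the lower terms. This shift by one
  index produces the factor 1/d.\<close>

lemma total_deg_generic_orbit:
  fixes c :: "nat \<Rightarrow> 'b::idom"
  assumes m: "m \<ge> 1" and d: "d > m" and i: "i \<in> {1..m}"
  shows "total_deg (generic_orbit d m c (Suc n) i) = d ^ n"
proof (induction n)
  case 0
  let ?y = "generic_orbit d m c (Suc 0) i" and ?t = "Poly_Mapping.single m 1 :: nat \<Rightarrow>\<^sub>0 nat"
  have y: "?y = Poly_Mapping.single 0 (c i ^ d) +
      (\<Sum>j=1..m. Poly_Mapping.single (Poly_Mapping.single j 1) (c i ^ (m - j)))"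
    using i by (simp add: generic_orbit_def Phi_orbit_Suc Phi_orbit_start single_0_power mult_single)
  have "total_deg ?y \<le> 1"
    unfolding y
    by (intro order.trans[OF total_deg_add_le] max.boundedI total_deg_sum_le order.trans[OF total_deg_single_le])
      (simp_all add: exp_deg_single exp_deg_def[of 0])
  \<comment> \<open>The last variable occurs with coefficient \<open>c i ^ 0 = 1\<close>, so the
    degree does not drop for any \<open>c\<close>.\<close>
  moreover have "Poly_Mapping.lookup ?y ?t = 1"
  proof -
    have "Poly_Mapping.single j (1::nat) = ?t \<longleftrightarrow> j = m" for j
      by (metis lookup_single_eq lookup_single_not_eq one_neq_zero)
    then have "Poly_Mapping.lookup ?y ?t = (c i ^ d when 0 = ?t) + (\<Sum>j=1..m. c i ^ (m - j) when j = m)"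
      unfolding y by (simp add: lookup_add lookup_sum lookup_single)
    also have "0 \<noteq> ?t" by (metis lookup_single_eq lookup_zero one_neq_zero)
    then have "(c i ^ d when 0 = ?t) = 0" by simp
    also have "(\<Sum>j=1..m. c i ^ (m - j) when j = m) = (\<Sum>j\<in>{m}. c i ^ (m - j) when j = m)"
      using m by (intro sum.mono_neutral_right) auto
    finally show ?thesis by simp
  qed
  then have "?t \<in> Poly_Mapping.keys ?y" by (simp add: in_keys_iff)
  then have "1 \<le> total_deg ?y" using exp_deg_le_total_deg[of ?t ?y] by (simp add: exp_deg_single)
  ultimately show ?case by simp
next
  case (Suc n)
  let ?y = "generic_orbit d m c (Suc n) i"
  let ?r = "\<Sum>j=1..m. Poly_Mapping.single (Poly_Mapping.single j 1) 1 * ?y ^ (m - j)"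
  have step: "generic_orbit d m c (Suc (Suc n)) i = ?y ^ d + ?r"
    using i unfolding generic_orbit_def by (subst Phi_orbit_Suc) auto
  have D: "d ^ n \<ge> 1" using d by simp
  have "?y \<noteq> 0" by (intro notI) (use Suc d in simp)
  then have top: "total_deg (?y ^ d) = d * d ^ n" by (simp add: total_deg_power Suc)
  have "total_deg ?r \<le> 1 + (m - 1) * d ^ n"
  proof (rule total_deg_sum_le)
    fix j assume j: "j \<in> {1..m}"
    have "total_deg (Poly_Mapping.single (Poly_Mapping.single j 1) 1 * ?y ^ (m - j)) \<le>
        total_deg (Poly_Mapping.single (Poly_Mapping.single j (1::nat)) (1::'b)) + total_deg (?y ^ (m - j))"
      by (rule total_deg_mult_le)
    also have "\<dots> \<le> 1 + (m - j) * d ^ n"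
      using total_deg_single_le[of "Poly_Mapping.single j (1::nat)" "1::'b"] total_deg_power_le[of ?y "m - j"]
      by (intro add_mono) (simp_all add: exp_deg_single Suc)
    also have "\<dots> \<le> 1 + (m - 1) * d ^ n" using j by (intro add_left_mono mult_right_mono) auto
    finally show "total_deg (Poly_Mapping.single (Poly_Mapping.single j 1) 1 * ?y ^ (m - j)) \<le> 1 + (m - 1) * d ^ n" .
  qed
  \<comment> \<open>The parameter itself adds degree 1, which is at most d^n.\<close>
  also have "\<dots> \<le> d ^ n + (m - 1) * d ^ n" using D by simp
  also have "\<dots> = m * d ^ n" using m by (metis mult.commute mult_eq_if not_one_le_zero)
  also have "\<dots> < d * d ^ n" using d D by simp
  finally show ?case unfolding step using top total_deg_add_eq[of ?r "?y ^ d"] by simp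
qed

text \<open>A coordinate equal to \<open>1\<close> makes every other coprime representative a multiple by a unit, i.e. by a constant.\<close>

lemma generic_height_eq:
  fixes y :: "nat \<Rightarrow> 'b::idom mpolys"
  assumes y: "\<And>i. i \<le> m \<Longrightarrow> y i \<in> polys_in m" "y 0 = 1"
    and x: "\<And>i. i \<le> m \<Longrightarrow> x i = frac_of_poly (y i)"
  shows "generic_height m x = real (MAX i\<in>{..m}. total_deg (y i))"
  unfolding generic_height_def
proof (rule the_equality)
  have "coprime_coords m y" unfolding coprime_coords_def using y(2) by (metis le0)
  then show "\<exists>y' s. s \<noteq> 0 \<and> (\<forall>i\<le>m. y' i \<in> polys_in m \<and> x i = s * frac_of_poly (y' i)) \<and>
      coprime_coords m y' \<and> real (MAX i\<in>{..m}. total_deg (y i)) = real (MAX i\<in>{..m}. total_deg (y' i))"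
    using y x by (intro exI[of _ y] exI[of _ 1]) auto
next
  fix h assume "\<exists>y' s. s \<noteq> 0 \<and> (\<forall>i\<le>m. y' i \<in> polys_in m \<and> x i = s * frac_of_poly (y' i)) \<and>
      coprime_coords m y' \<and> h = real (MAX i\<in>{..m}. total_deg (y' i))"
  then obtain y' s where y': "\<And>i. i \<le> m \<Longrightarrow> y' i \<in> polys_in m" "\<And>i. i \<le> m \<Longrightarrow> x i = s * frac_of_poly (y' i)"
      "coprime_coords m y'" "h = real (MAX i\<in>{..m}. total_deg (y' i))" by blast
  have s: "s * frac_of_poly (y' 0) = 1" using y'(2)[of 0] x[of 0] y(2) by (simp add: frac_of_poly_hom)
  have eq: "y' i = y' 0 * y i" if "i \<le> m" for i
  proof -
    have "frac_of_poly (y' 0 * y i) = frac_of_poly (y' 0) * (s * frac_of_poly (y' i))"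
      using y'(2)[OF that] x[OF that] by (simp add: frac_of_poly_hom)
    also have "\<dots> = (s * frac_of_poly (y' 0)) * frac_of_poly (y' i)" by (simp only: mult_ac)
    also have "\<dots> = frac_of_poly (y' i)" using s by simp
    finally show ?thesis by (simp add: frac_of_poly_hom(5))
  qed
  then have "y' 0 dvd 1" using y'(1,3) unfolding coprime_coords_def by (metis dvd_triv_left le0)
  then obtain u where u: "1 = y' 0 * u" by (elim dvdE)
  then have "y' 0 \<noteq> 0" "u \<noteq> 0" by auto
  then have "total_deg (y' 0) = 0" using total_deg_mult[of "y' 0" u] u by simp
  then have "total_deg (y' i) = total_deg (y i)" if "i \<le> m" for i
    using eq[OF that] total_deg_mult[of "y' 0" "y i"] \<open>y' 0 \<noteq> 0\<close> by (cases "y i = 0") auto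
  then show "h = real (MAX i\<in>{..m}. total_deg (y i))" using y'(4) by (auto cong: image_cong_simp)
qed

text \<open>The iterate n + 1 has height d^n, so the defining sequence is constant from index 1
  on.\<close>

lemma canonical_height_generic:
  fixes c :: "nat \<Rightarrow> 'b::idom"
  assumes "m \<ge> 1" "d > m"
  shows "canonical_height (generic_height m) d (Phi d m frac_var) (affine_point (\<lambda>i. frac_const (c i))) = 1 / real d"
proof -
  have h: "generic_height m ((Phi d m frac_var ^^ Suc n) (affine_point (\<lambda>i. frac_const (c i)))) = real (d ^ n)" for n
  proof -
    have "generic_height m (Phi_orbit d m frac_var (\<lambda>i. frac_const (c i)) (Suc n)) =
        real (MAX i\<in>{..m}. total_deg (generic_orbit d m c (Suc n) i))"
      by (rule generic_height_eq) (simp_all add: generic_orbit_in Phi_orbit_frac, simp add: generic_orbit_def)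
    also have "(MAX i\<in>{..m}. total_deg (generic_orbit d m c (Suc n) i)) = d ^ n"
    proof (rule Max_eqI)
      show "d ^ n \<in> (\<lambda>i. total_deg (generic_orbit d m c (Suc n) i)) ` {..m}"
        using total_deg_generic_orbit[OF assms, of 1 c n] assms(1) by force
      fix k assume "k \<in> (\<lambda>i. total_deg (generic_orbit d m c (Suc n) i)) ` {..m}"
      then obtain i where i: "i \<le> m" "k = total_deg (generic_orbit d m c (Suc n) i)" by auto
      show "k \<le> d ^ n"
        using total_deg_generic_orbit[OF assms, of i c n] i by (cases "i = 0") (simp_all add: generic_orbit_def)
    qed simp
    finally show ?thesis by (simp add: Phi_orbit_def)
  qed
  have "generic_height m ((Phi d m frac_var ^^ n) (affine_point (\<lambda>i. frac_const (c i)))) / real d ^ n = 1 / real d"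
    if "n \<ge> 1" for n
    using h[of "n - 1"] that assms by (cases n) (simp_all del: funpow.simps)
  then have "(\<lambda>n. generic_height m ((Phi d m frac_var ^^ n) (affine_point (\<lambda>i. frac_const (c i)))) / real d ^ n)
      \<longlonglongrightarrow> 1 / real d"
    by (intro tendsto_eventually eventually_sequentiallyI[of 1])
  then show ?thesis unfolding canonical_height_def by (rule limI)
qed

section \<open>The specialized height\<close>

text \<open>\<open>b j i\<close> is the coefficient of X^(m - j) in the i-th Lagrange polynomial.
  Interpolating X^(m - k), of degree below m, at the m points reproduces it; comparing coefficients
  gives the claim.\<close>

lemma inverse_Vandermonde:
  fixes c :: "nat \<Rightarrow> 'a::field"
  assumes inj: "inj_on c {1..m}"
  shows "\<exists>b. \<forall>j\<in>{1..m}. \<forall>k\<in>{1..m}. (\<Sum>i=1..m. b j i * c i ^ (m - k)) = (if j = k then 1 else 0)"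
proof -
  define lag where "lag i = (\<Prod>k\<in>{1..m} - {i}. Polynomial.smult (1 / (c i - c k)) [:- c k, 1:])" for i
  have eval: "poly (lag i) (c j) = (if i = j then 1 else 0)" if ij: "i \<in> {1..m}" "j \<in> {1..m}" for i j
  proof (cases "i = j")
    case True
    have "c i - c k \<noteq> 0" if "k \<in> {1..m} - {i}" for k using inj ij that by (auto dest: inj_onD)
    then have "poly (lag i) (c i) = (\<Prod>k\<in>{1..m} - {i}. 1)"
      unfolding lag_def poly_prod by (intro prod.cong refl) (auto simp: diff_divide_distrib[symmetric])
    then show ?thesis using True by simp
  next
    case False
    then have "(\<Prod>k\<in>{1..m} - {i}. poly (Polynomial.smult (1 / (c i - c k)) [:- c k, 1:]) (c j)) = 0"
      using ij by (intro prod_zero bexI[of _ j]) auto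
    then show ?thesis using False by (simp add: lag_def poly_prod)
  qed
  have deg: "Polynomial.degree (lag i) < m" if i: "i \<in> {1..m}" for i
  proof -
    have "Polynomial.degree (lag i) \<le> (\<Sum>k\<in>{1..m} - {i}. Polynomial.degree (Polynomial.smult (1 / (c i - c k)) [:- c k, 1:]))"
      unfolding lag_def by (rule order.trans[OF degree_prod_sum_le]) (simp_all only: comp_def finite_Diff finite_atLeastAtMost order_refl)
    also have "\<dots> \<le> (\<Sum>k\<in>{1..m} - {i}. 1)"
      by (intro sum_mono) (auto intro: order.trans[OF degree_smult_le])
    also have "\<dots> < m" using i by simp
    finally show ?thesis .
  qed
  have "(\<Sum>i=1..m. Polynomial.coeff (lag i) (m - j) * c i ^ (m - k)) = (if j = k then 1 else 0)"
    if jk: "j \<in> {1..m}" "k \<in> {1..m}" for j k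
  proof -
    let ?q = "Polynomial.monom 1 (m - k) :: 'a poly"
    let ?r = "\<Sum>i=1..m. Polynomial.smult (c i ^ (m - k)) (lag i)"
    have card: "card (c ` {1..m}) = m" using card_image[OF inj] by simp
    have "?q = ?r"
    proof (rule poly_eqI_degree[of "c ` {1..m}"])
      show "Polynomial.degree ?q < card (c ` {1..m})" unfolding card using jk by (simp add: degree_monom_eq)
      have "Polynomial.degree ?r \<le> m - 1"
        using deg by (intro degree_sum_le) (auto intro!: order.trans[OF degree_smult_le] simp: Suc_leI le_diff_conv2 less_imp_Suc_add)
      moreover have "0 < m" using jk by simp
      ultimately show "Polynomial.degree ?r < card (c ` {1..m})" unfolding card by linarith
      fix x assume "x \<in> c ` {1..m}"
      then obtain i where i: "i \<in> {1..m}" "x = c i" by blast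
      have "poly ?r x = (\<Sum>i'=1..m. c i' ^ (m - k) * (if i' = i then 1 else 0))"
        unfolding poly_sum using i eval by (intro sum.cong) simp_all
      also have "\<dots> = c i ^ (m - k)" using i by (simp add: if_distrib cong: if_cong)
      finally show "poly ?q x = poly ?r x" using i by (simp add: poly_monom)
    qed
    then have "Polynomial.coeff ?q (m - j) = Polynomial.coeff ?r (m - j)" by simp
    moreover have "m - k = m - j \<longleftrightarrow> j = k" using jk by auto
    ultimately show ?thesis by (simp add: coeff_sum mult.commute)
  qed
  then show ?thesis by (intro exI[of _ "\<lambda>j i. Polynomial.coeff (lag i) (m - j)"]) blast
qed

section \<open>Summing the local estimates over places and conjugates\<close>

context place_family
begin

lemma canonical_height_specialization:
  assumes m: "m \<ge> 2" and inj: "inj_on c {1..m}"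
  shows "\<exists>C. \<forall>d>m. \<forall>l.
    \<bar>canonical_height (weil_height \<Omega> N E m) d (Phi d m l) (affine_point c)
      - 1 / real d * weil_height \<Omega> N E m (affine_point l)\<bar> \<le> C"
proof -
  obtain b where b: "\<And>j k. j \<in> {1..m} \<Longrightarrow> k \<in> {1..m} \<Longrightarrow>
      (\<Sum>i=1..m. b j i * c i ^ (m - k)) = (if j = k then 1 else 0)"
    using inverse_Vandermonde[OF inj] by blast
  \<comment> \<open>The starting point and the inverse matrix must be bounded together, under all
    embeddings.\<close>
  define Z where "Z = c ` {1..m} \<union> (\<lambda>(j, i). b j i) ` ({1..m} \<times> {1..m})"
  have Z: "finite Z" "\<And>i. i \<in> {1..m} \<Longrightarrow> c i \<in> Z" "\<And>i j. i \<in> {1..m} \<Longrightarrow> j \<in> {1..m} \<Longrightarrow> b j i \<in> Z"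
    by (auto simp: Z_def)
  obtain B where B: "\<And>z. z \<in> Z \<Longrightarrow> conjugates_bound z B"
    using uniform_conjugates_bound[OF Z(1)] by blast
  have "conjugates_bound (c 1) B" using B Z(2) m by simp
  then have B1: "finite {v \<in> \<Omega>. B v \<noteq> 1}" "\<And>v. v \<in> \<Omega> \<Longrightarrow> 1 \<le> B v" by (auto simp: conjugates_bound_def)
  \<comment> \<open>The error allowed at one place: none where the ultrametric computation is exact,
    the general bound elsewhere. It is fixed before \<open>d\<close> and \<open>l\<close>
    appear.\<close>
  define \<kappa> where "\<kappa> v = (if v \<in> ultra_places \<and> B v = 1 then 0 else 4 * ln (2 * real m) + 9 * ln (B v))" for v
  define T0 where "T0 = (\<Omega> - ultra_places) \<union> {v \<in> \<Omega>. B v \<noteq> 1}"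
  have T0: "finite T0" using finite_not_ultra B1(1) by (simp add: T0_def)
  have \<kappa>0: "\<kappa> v = 0" if "v \<in> \<Omega> - T0" for v using that by (auto simp: T0_def \<kappa>_def)
  have "\<bar>canonical_height (weil_height \<Omega> N E m) d (Phi d m l) (affine_point c)
      - 1 / real d * weil_height \<Omega> N E m (affine_point l)\<bar> \<le> (\<Sum>v\<in>T0. real (N v) * \<kappa> v)"
    if d: "d > m" for d l
  proof -
    obtain Bl where Bl: "\<And>z. z \<in> l ` {1..m} \<Longrightarrow> conjugates_bound z Bl"
      using uniform_conjugates_bound[of "l ` {1..m}"] by blast
    have "conjugates_bound (l 1) Bl" using Bl m by simp
    then have finBl: "finite {v \<in> \<Omega>. Bl v \<noteq> 1}" by (auto simp: conjugates_bound_def)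
    \<comment> \<open>\<open>T\<close> depends on \<open>l\<close> and only makes the heights finite
      sums; the error will live on \<open>T0\<close>.\<close>
    define T where "T = T0 \<union> {v \<in> \<Omega>. Bl v \<noteq> 1}"
    have T: "finite T" "T \<subseteq> \<Omega>" "T0 \<subseteq> T" using T0 finBl by (auto simp: T_def T0_def)
    define S where "S = Z \<union> l ` {1..m}"
    have S: "finite S" using Z by (simp add: S_def)
    define L where "L = alg_gen S"
    have L: "K_subalgebra L" unfolding L_def by (rule K_subalgebra_alg_gen)
    have SL: "S \<subseteq> L" unfolding L_def by (rule alg_gen_superset)
    have lL: "l j \<in> L" and cL: "c j \<in> L" and bL: "i \<in> {1..m} \<Longrightarrow> b j i \<in> L" if "j \<in> {1..m}" for i j
      using SL Z that by (auto simp: S_def)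
    define M where "M v \<sigma> n = (MAX i\<in>{..m}. E v (Phi_orbit d m (\<sigma> \<circ> l) (\<sigma> \<circ> c) n i))" for v \<sigma> n
    define \<Lambda> where "\<Lambda> v \<sigma> = (MAX i\<in>{..m}. E v (affine_point (\<sigma> \<circ> l) i))" for v \<sigma>
    have local: "local_orbit_bounded (E v) d m (\<sigma> \<circ> c) (\<lambda>j i. \<sigma> (b j i)) (B v)"
      if v: "v \<in> \<Omega>" and \<sigma>: "\<sigma> \<in> K_embeddings L" for v \<sigma>
    proof -
      interpret abs_val "E v" by (rule abs_val_E[OF v])
      have hom: "K_hom L \<sigma>" using \<sigma> K_embeddings_iff[OF L] by blast
      have bound: "E v (\<sigma> z) \<le> B v" if "z \<in> Z" for z
        using B[OF that] v L hom SL that unfolding conjugates_bound_def S_def by blast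
      show ?thesis
      proof
        fix j k assume jk: "j \<in> {1..m}" "k \<in> {1..m}"
        have "(\<Sum>i=1..m. \<sigma> (b j i) * (\<sigma> \<circ> c) i ^ (m - k)) = (\<Sum>i=1..m. \<sigma> (b j i * c i ^ (m - k)))"
          by (intro sum.cong refl)
            (simp add: K_hom_mult[OF L hom bL[OF jk(1)]] K_hom_power[OF L hom cL] K_subalgebra_power[OF L cL])
        also have "\<dots> = \<sigma> (\<Sum>i=1..m. b j i * c i ^ (m - k))"
          by (rule K_hom_sum[OF L hom, symmetric])
            (intro K_subalgebra_mult[OF L] K_subalgebra_power[OF L] cL bL[OF jk(1)])
        finally show "(\<Sum>i=1..m. \<sigma> (b j i) * (\<sigma> \<circ> c) i ^ (m - k)) = (if j = k then 1 else 0)"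
          unfolding b[OF jk] by (simp add: K_hom_0[OF L hom] K_hom_1[OF L hom])
      qed (use m d B1(2)[OF v] bound Z in auto)
    qed
    have ultra: "local_orbit_ultra (E v) d m (\<sigma> \<circ> c) (\<lambda>j i. \<sigma> (b j i))"
      if v: "v \<in> ultra_places" "B v = 1" and \<sigma>: "\<sigma> \<in> K_embeddings L" for v \<sigma>
    proof -
      have "v \<in> \<Omega>" using v by (simp add: ultra_places_def)
      from local[OF this \<sigma>] show ?thesis
        using ultra_abs_val_E[OF v(1)] v(2) by (simp add: local_orbit_ultra_def)
    qed
    have "\<exists>g. (\<lambda>n. ln (M v \<sigma> n) / real d ^ n) \<longlonglongrightarrow> g \<and> \<bar>g - ln (\<Lambda> v \<sigma>) / real d\<bar> \<le> \<kappa> v"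
      if v: "v \<in> \<Omega>" and \<sigma>: "\<sigma> \<in> K_embeddings L" for v \<sigma>
    proof (cases "v \<in> ultra_places \<and> B v = 1")
      case True
      interpret U: local_orbit_ultra "E v" d m "\<sigma> \<circ> l" "\<sigma> \<circ> c" "\<lambda>j i. \<sigma> (b j i)"
        using ultra True \<sigma> by blast
      show ?thesis
        using U.ultra_limit True by (intro exI[of _ "ln (\<Lambda> v \<sigma>) / real d"])
          (simp add: M_def \<Lambda>_def U.M_def U.\<Lambda>_def \<kappa>_def)
    next
      case False
      interpret A: local_orbit_bounded "E v" d m "\<sigma> \<circ> l" "\<sigma> \<circ> c" "\<lambda>j i. \<sigma> (b j i)" "B v"
        using local v \<sigma> by blast
      show ?thesis
        using A.archimedean_limit unfolding M_def \<Lambda>_def A.M_def A.\<Lambda>_def \<kappa>_def if_not_P[OF False] .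
    qed
    then obtain g where g: "\<And>v \<sigma>. v \<in> \<Omega> \<Longrightarrow> \<sigma> \<in> K_embeddings L \<Longrightarrow>
        (\<lambda>n. ln (M v \<sigma> n) / real d ^ n) \<longlonglongrightarrow> g v \<sigma> \<and> \<bar>g v \<sigma> - ln (\<Lambda> v \<sigma>) / real d\<bar> \<le> \<kappa> v"
      by metis
    have triv: "\<Lambda> v \<sigma> = 1 \<and> M v \<sigma> n = 1" if v: "v \<in> \<Omega> - T" and \<sigma>: "\<sigma> \<in> K_embeddings L" for v \<sigma> n
    proof -
      have v': "v \<in> \<Omega>" "v \<in> ultra_places" "B v = 1" "Bl v = 1" using v by (auto simp: T_def T0_def)
      interpret U: local_orbit_ultra "E v" d m "\<sigma> \<circ> l" "\<sigma> \<circ> c" "\<lambda>j i. \<sigma> (b j i)"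
        using ultra v' \<sigma> by blast
      have hom: "K_hom L \<sigma>" using \<sigma> K_embeddings_iff[OF L] by blast
      have "E v (\<sigma> (l j)) \<le> 1" if j: "j \<in> {1..m}" for j
      proof -
        have "E v (\<sigma> (l j)) \<le> Bl v"
          using Bl[OF imageI[OF j]] v'(1) L hom lL[OF j] unfolding conjugates_bound_def by blast
        then show ?thesis using v' by simp
      qed
      then have "U.\<Lambda> \<le> 1" by (intro U.\<Lambda>_le) simp_all
      then have "U.\<Lambda> = 1" using U.\<Lambda>_ge_1 by simp
      then show ?thesis using U.M_trivial unfolding M_def \<Lambda>_def U.M_def U.\<Lambda>_def by blast
    qed
    define D where "D = real (ext_degree L)"
    have D: "D > 0" "real (card (K_embeddings L)) = D"
      using card_K_embeddings_alg_gen[OF S] by (simp_all add: D_def L_def)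
    have orb: "(MAX i\<in>{..m}. E v (\<sigma> (Phi_orbit d m l c n i))) = M v \<sigma> n" if "\<sigma> \<in> K_embeddings L" for v \<sigma> n
    proof -
      have "K_hom L \<sigma>" using that K_embeddings_iff[OF L] by blast
      then have "\<sigma> (Phi_orbit d m l c n i) = Phi_orbit d m (\<sigma> \<circ> l) (\<sigma> \<circ> c) n i" if "i \<le> m" for i
        using that by (intro K_hom_orbit[OF L]) (use lL cL in auto)
      then show ?thesis unfolding M_def
        by (intro arg_cong[where f = Max] image_cong refl) simp
    qed
    have par: "(MAX i\<in>{..m}. E v (\<sigma> (affine_point l i))) = \<Lambda> v \<sigma>" if "\<sigma> \<in> K_embeddings L" for v \<sigma>
    proof -
      have "K_hom L \<sigma>" using that K_embeddings_iff[OF L] by blast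
      then show ?thesis unfolding \<Lambda>_def
        by (intro arg_cong[where f = Max] image_cong refl) (simp add: affine_point_def K_hom_1[OF L])
    qed
    have Phi_orbit_in: "Phi_orbit d m l c n i \<in> L" if "i \<le> m" for n i
      using that by (intro Phi_orbit_in_subalgebra[OF L]) (use lL cL in auto)
    have h_orbit: "weil_height \<Omega> N E m (Phi_orbit d m l c n) =
        (\<Sum>v\<in>T. \<Sum>\<sigma>\<in>K_embeddings L. real (N v) * ln (M v \<sigma> n)) / D" for n
      using weil_height_alg_gen[OF S, of m "Phi_orbit d m l c n" T] T triv orb
        Phi_orbit_in
      by (simp add: L_def D_def cong: sum.cong)
    have h_param: "weil_height \<Omega> N E m (affine_point l) =
        (\<Sum>v\<in>T. \<Sum>\<sigma>\<in>K_embeddings L. real (N v) * ln (\<Lambda> v \<sigma>)) / D"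
    proof -
      have "affine_point l i \<in> L" if "i \<le> m" for i
        using lL[of i] K_subalgebra_1[OF L] that by (cases "i = 0") (auto simp: affine_point_def)
      then show ?thesis
        using weil_height_alg_gen[OF S, of m "affine_point l" T] T triv par
        by (simp add: L_def D_def cong: sum.cong)
    qed
    \<comment> \<open>Finitely many places and embeddings are involved, so the limit may be taken
      term by term.\<close>
    have "(\<lambda>n. (\<Sum>v\<in>T. \<Sum>\<sigma>\<in>K_embeddings L. real (N v) * (ln (M v \<sigma> n) / real d ^ n)) / D)
        \<longlonglongrightarrow> (\<Sum>v\<in>T. \<Sum>\<sigma>\<in>K_embeddings L. real (N v) * g v \<sigma>) / D"
      using g T(2) by (intro tendsto_divide tendsto_sum tendsto_mult tendsto_const) (use D in auto)
    then have "(\<lambda>n. weil_height \<Omega> N E m ((Phi d m l ^^ n) (affine_point c)) / real d ^ n)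
        \<longlonglongrightarrow> (\<Sum>v\<in>T. \<Sum>\<sigma>\<in>K_embeddings L. real (N v) * g v \<sigma>) / D"
      unfolding Phi_orbit_def[symmetric] h_orbit
      by (simp add: sum_divide_distrib mult.commute[of D])
    then have "canonical_height (weil_height \<Omega> N E m) d (Phi d m l) (affine_point c) =
        (\<Sum>v\<in>T. \<Sum>\<sigma>\<in>K_embeddings L. real (N v) * g v \<sigma>) / D"
      unfolding canonical_height_def by (rule limI)
    moreover have "1 / real d * weil_height \<Omega> N E m (affine_point l) =
        (\<Sum>v\<in>T. \<Sum>\<sigma>\<in>K_embeddings L. real (N v) * (ln (\<Lambda> v \<sigma>) / real d)) / D"
      unfolding h_param by (simp add: sum_divide_distrib mult.commute)
    ultimately have "canonical_height (weil_height \<Omega> N E m) d (Phi d m l) (affine_point c)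
        - 1 / real d * weil_height \<Omega> N E m (affine_point l) =
        (\<Sum>v\<in>T. \<Sum>\<sigma>\<in>K_embeddings L. real (N v) * (g v \<sigma> - ln (\<Lambda> v \<sigma>) / real d)) / D"
      by (simp only: diff_divide_distrib[symmetric] sum_subtractf[symmetric] right_diff_distrib[symmetric])
    also have "\<bar>\<dots>\<bar> \<le> (\<Sum>v\<in>T. \<Sum>\<sigma>\<in>K_embeddings L. real (N v) * \<kappa> v) / D"
    proof -
      have "\<bar>\<Sum>v\<in>T. \<Sum>\<sigma>\<in>K_embeddings L. real (N v) * (g v \<sigma> - ln (\<Lambda> v \<sigma>) / real d)\<bar> \<le>
          (\<Sum>v\<in>T. \<Sum>\<sigma>\<in>K_embeddings L. real (N v) * \<kappa> v)"
      proof (rule order.trans[OF sum_abs], rule sum_mono, rule order.trans[OF sum_abs], rule sum_mono)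
        fix v \<sigma> assume "v \<in> T" "\<sigma> \<in> K_embeddings L"
        then have "\<bar>g v \<sigma> - ln (\<Lambda> v \<sigma>) / real d\<bar> \<le> \<kappa> v" using g T(2) by blast
        then show "\<bar>real (N v) * (g v \<sigma> - ln (\<Lambda> v \<sigma>) / real d)\<bar> \<le> real (N v) * \<kappa> v"
          by (simp add: abs_mult mult_left_mono)
      qed
      then show ?thesis using D(1) by (simp add: divide_right_mono)
    qed
    \<comment> \<open>There are exactly \<open>D\<close> embeddings, so averaging a bound that does
      not depend on \<open>\<sigma>\<close> returns it. Removing the places where
      \<open>\<kappa>\<close> is zero then eliminates \<open>l\<close>.\<close>
    also have "\<dots> = (\<Sum>v\<in>T. real (N v) * \<kappa> v)"
      using D by (simp add: sum_distrib_left[symmetric])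
    also have "\<dots> = (\<Sum>v\<in>T0. real (N v) * \<kappa> v)"
      using T \<kappa>0 by (intro sum.mono_neutral_right) auto
    finally show ?thesis .
  qed
  then show ?thesis by blast
qed

end

theorem theorem2p1:
  fixes \<Omega> :: "('k::field_char_0 \<Rightarrow> real) set"
    and N :: "('k \<Rightarrow> real) \<Rightarrow> nat"
    and E :: "('k \<Rightarrow> real) \<Rightarrow> 'k alg_closure \<Rightarrow> real"
    and m :: nat
    and c :: "nat \<Rightarrow> 'k alg_closure"
  assumes "standard_places \<Omega>"
    and "product_formula \<Omega> N"
    and "\<And>v. v \<in> \<Omega> \<Longrightarrow> extends_to_closure v (E v)"
    and "m \<ge> 2"
    and "inj_on c {1..m}"
  shows "\<exists>C. \<forall>d>m. \<forall>l :: nat \<Rightarrow> 'k alg_closure.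
    \<bar>canonical_height (weil_height \<Omega> N E m) d (Phi d m l) (affine_point c)
      - canonical_height (generic_height m) d (Phi d m frac_var) (affine_point (\<lambda>i. frac_const (c i)))
          * weil_height \<Omega> N E m (affine_point l)\<bar> \<le> C"
proof -
  interpret place_family \<Omega> N E
    using assms(1-3) by unfold_locales
  have "canonical_height (generic_height m) d (Phi d m frac_var) (affine_point (\<lambda>i. frac_const (c i))) = 1 / real d"
    if "d > m" for d
    using assms(4) that by (intro canonical_height_generic) auto
  then show ?thesis
    using canonical_height_specialization[OF assms(4,5)] by (simp only: cong: imp_cong)
qed

end
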